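(* Let $\mathcal{H}$ be a Hilbert space and let $T=(T_1,\dots,T_n)\in\mathcal{T}^{q,n}(\mathcal{H})$ be a pure tuple satisfying Szegő positivity. Let $D_{T^*}=\mathbb{S}_n^{-1}(T,T^* )^{1/2}$, $\mathcal{D}_{T^*}=\overline{\mathrm{ran}}\,\mathbb{S}_n^{-1}(T,T^* )$, and let $\Pi:\mathcal{H}\to H^2_{\mathcal{D}_{T^*}}(\mathbb{D}^n)$ be the map $$\Pi h(\boldsymbol{z})=\sum_{\boldsymbol{k}\in\mathbb{Z}_+^n}\Big(\prod_{1\le i<j\le n}q(i,j)^{\frac{k_ik_j}{2}}\Big)D_{T^*}T^{*\boldsymbol{k}}h\,\boldsymbol{z}^{\boldsymbol{k}} .$$ Then $\Pi$ is an isometry and $$\Pi T_m^*=(M_{z_m}R_{[q]_m})^*\Pi\qquad\text{for all } m=1,\dots,n.$$ In other words, the tuple $(M_{z_1}R_{[q]_1},\dots,M_{z_n}R_{[q]_n})$ on $H^2_{\mathcal{D}_{T^*}}(\mathbb{D}^n)$ is an isometric dilation of the $q$-commuting tuple $T$.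
   Context: All Hilbert spaces are complex; $\mathbb{Z}_+$ is the set of non-negative integers; $\mathbb{T}$ is the unit circle. Fix $n$ and a function $q:\{1,\dots,n\}\times\{1,\dots,n\}\to\mathbb{T}$ with $q(i,i)=1$ and $q(i,j)=\overline{q(j,i)}$ for all $i,j$. $\mathcal{T}^{q,n}(\mathcal{H})$ is the set of $n$-tuples $(T_1,\dots,T_n)$ of contractions on $\mathcal{H}$ with $T_iT_j=q(i,j)T_jT_i$ for all $i,j$. The tuple is pure if $\|T_i^{*m}h\|\to0$ as $m\to\infty$ for every $i$ and every $h\in\mathcal{H}$. For $F=\{k_1<\dots<k_r\}\subset\{1,\dots,n\}$ put $T_F=T_{k_1}\cdots T_{k_r}$, $T_F^*=T_{k_r}^*\cdots T_{k_1}^*$, $T_\emptyset=I$. Set $\mathbb{S}_n^{-1}(T,T^* )=\sum_{F\subset\{1,\dots,n\}}(-1)^{|F|}T_FT_F^*$; $T$ satisfies Szegő positivity if $\mathbb{S}_n^{-1}(T,T^* )\ge0$. For $\boldsymbol{k}=(k_1,\dots,k_n)\in\mathbb{Z}_+^n$, $T^{\boldsymbol k}=T_1^{k_1}\cdots T_n^{k_n}$ and $T^{*\boldsymbol{k}}=T_n^{*k_n}\cdots T_1^{*k_1}$ (in this order). For a Hilbert space $\mathcal{E}$, $H^2_{\mathcal{E}}(\mathbb{D}^n)$ is the $\mathcal{E}$-valued Hardy space of power series $\sum_{\boldsymbol{k}\in\mathbb{Z}_+^n}a_{\boldsymbol{k}}\boldsymbol{z}^{\boldsymbol{k}}$, $a_{\boldsymbol{k}}\in\mathcal{E}$,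 with norm squared $\sum\|a_{\boldsymbol{k}}\|^2<\infty$. $M_{z_m}$ is multiplication by $z_m$, and $$R_{[q]_m}\Big(\sum_{\boldsymbol{k}}a_{\boldsymbol{k}}\boldsymbol{z}^{\boldsymbol{k}}\Big)=\sum_{\boldsymbol{k}}a_{\boldsymbol{k}}\Big(\prod_{i=1}^n q(m,i)^{\frac{k_i}{2}}\Big)\boldsymbol{z}^{\boldsymbol{k}} .$$ The square roots $q(i,j)^{1/2}$ are fixed so that $q(i,i)^{1/2}=1$ and $q(j,i)^{1/2}=\overline{q(i,j)^{1/2}}$ for all $i,j$, and $q(i,j)^{k/2}:=(q(i,j)^{1/2})^k$. A tuple $V=(V_1,\dots,V_n)\in\mathcal{T}^{q,n}(\mathcal{K})$ of isometries is called an isometric dilation of $T$ here if there is an isometry $\Pi:\mathcal{H}\to\mathcal{K}$ with $\Pi T_m^*=V_m^*\Pi$ for all $m$; then, with $\mathcal{R}=\mathrm{ran}\,\Pi$, $T^{\boldsymbol{k}}$ is unitarily equivalent (via $\Pi$) to $P_{\mathcal{R}}V^{\boldsymbol{k}}|_{\mathcal{R}}$ for all $\boldsymbol{k}\in\mathbb{Z}_+^n$. *)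

theory Defs
  imports "HOL-Analysis.Analysis" "HOL-Library.Function_Algebras" "HOL-Library.Nonpos_Ints"
begin

section \<open>Complex Hilbert spaces\<close>

class complex_vector = ab_group_add +
  fixes scaleC :: "complex \<Rightarrow> 'a \<Rightarrow> 'a" (infixr "*\<^sub>C" 75)
  assumes scaleC_add_right: "c *\<^sub>C (x + y) = c *\<^sub>C x + c *\<^sub>C y"
    and scaleC_add_left: "(c + d) *\<^sub>C x = c *\<^sub>C x + d *\<^sub>C x"
    and scaleC_scaleC: "c *\<^sub>C d *\<^sub>C x = (c * d) *\<^sub>C x"
    and scaleC_one: "1 *\<^sub>C x = x"

class complex_inner = complex_vector + real_normed_vector +
  fixes cinner :: "'a \<Rightarrow> 'a \<Rightarrow> complex"
  assumes scaleR_scaleC: "r *\<^sub>R x = complex_of_real r *\<^sub>C x"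
    and cinner_commute: "cinner x y = cnj (cinner y x)"
    and cinner_add_left: "cinner (x + y) z = cinner x z + cinner y z"
    and cinner_scaleC_left: "cinner (c *\<^sub>C x) y = c * cinner x y"
    and cinner_nonneg: "cinner x x \<in> \<real>\<^sub>\<ge>\<^sub>0"
    and norm_eq_sqrt_cinner: "norm x = sqrt (Re (cinner x x))"

class chilbert_space = complex_inner + complete_space

instantiation complex :: chilbert_space
begin

definition scaleC_complex :: "complex \<Rightarrow> complex \<Rightarrow> complex"
  where "scaleC_complex c x = c * x"

definition cinner_complex :: "complex \<Rightarrow> complex \<Rightarrow> complex"
  where "cinner_complex x y = x * cnj y"

instance
proof
  fix x y z c d :: complex and r :: real
  show "cinner x x \<in> \<real>\<^sub>\<ge>\<^sub>0"
    by (simp add: cinner_complex_def complex_nonneg_Reals_iff)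
  show "norm x = sqrt (Re (cinner x x))"
    by (simp add: cinner_complex_def cmod_def power2_eq_square)
qed (simp_all add: scaleC_complex_def cinner_complex_def algebra_simps scaleR_conv_of_real)

end

instantiation "fun" :: (type, complex_vector) complex_vector
begin

definition scaleC_fun :: "complex \<Rightarrow> ('a \<Rightarrow> 'b) \<Rightarrow> 'a \<Rightarrow> 'b"
  where "scaleC_fun c f = (\<lambda>x. c *\<^sub>C f x)"

instance
  by standard
    (simp_all add: scaleC_fun_def fun_eq_iff scaleC_add_right scaleC_add_left scaleC_scaleC scaleC_one)

end

text \<open>The Hardy spaces below are spaces of functions with values in a closed subspace of a given
  Hilbert space. Hence Hilbert spaces are also treated as a carrier set with an inner product;
  a type of class \<open>chilbert_space\<close> is the case \<open>UNIV\<close>, \<open>cinner\<close>.\<close>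

definition ip_norm :: "('a \<Rightarrow> 'a \<Rightarrow> complex) \<Rightarrow> 'a \<Rightarrow> real"
  where "ip_norm ip x = sqrt (Re (ip x x))"

locale hilbert_space_on =
  fixes K :: "'a::complex_vector set" and ip :: "'a \<Rightarrow> 'a \<Rightarrow> complex"
  assumes zero_mem: "0 \<in> K"
    and add_mem: "x \<in> K \<Longrightarrow> y \<in> K \<Longrightarrow> x + y \<in> K"
    and scale_mem: "x \<in> K \<Longrightarrow> c *\<^sub>C x \<in> K"
    and ip_commute: "x \<in> K \<Longrightarrow> y \<in> K \<Longrightarrow> ip x y = cnj (ip y x)"
    and ip_add_left: "x \<in> K \<Longrightarrow> y \<in> K \<Longrightarrow> z \<in> K \<Longrightarrow> ip (x + y) z = ip x z + ip y z"
    and ip_scale_left: "x \<in> K \<Longrightarrow> y \<in> K \<Longrightarrow> ip (c *\<^sub>C x) y = c * ip x y"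
    and ip_nonneg: "x \<in> K \<Longrightarrow> ip x x \<in> \<real>\<^sub>\<ge>\<^sub>0"
    and ip_definite: "x \<in> K \<Longrightarrow> ip x x = 0 \<Longrightarrow> x = 0"
    and complete: "(\<And>j. X j \<in> K) \<Longrightarrow>
        (\<And>e. e > 0 \<Longrightarrow> \<exists>N. \<forall>i\<ge>N. \<forall>j\<ge>N. ip_norm ip (X i - X j) < e) \<Longrightarrow>
        \<exists>L\<in>K. (\<lambda>j. ip_norm ip (X j - L)) \<longlonglongrightarrow> 0"

lemma ip_norm_cinner [simp]: "ip_norm cinner = (norm :: 'a::complex_inner \<Rightarrow> real)"
  by (simp add: fun_eq_iff ip_norm_def norm_eq_sqrt_cinner)

lemma hilbert_space_on_UNIV: "hilbert_space_on (UNIV :: 'a::chilbert_space set) cinner"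
proof
  fix x :: 'a
  assume "cinner x x = 0"
  then show "x = 0"
    using norm_eq_sqrt_cinner[of x] by simp
next
  fix X :: "nat \<Rightarrow> 'a"
  assume "\<exists>N. \<forall>i\<ge>N. \<forall>j\<ge>N. ip_norm cinner (X i - X j) < e" if "e > 0" for e
  then have "Cauchy X"
    by (simp add: Cauchy_def dist_norm)
  then obtain L where "X \<longlonglongrightarrow> L"
    using Cauchy_convergent convergent_def by blast
  then show "\<exists>L\<in>UNIV. (\<lambda>j. ip_norm cinner (X j - L)) \<longlonglongrightarrow> 0"
    using tendsto_norm_zero[OF LIM_zero[of X L sequentially]] by auto
next
  fix x y :: 'a
  show "cinner x y = cnj (cinner y x)"
    by (rule cinner_commute)
qed (simp_all add: cinner_add_left cinner_scaleC_left cinner_nonneg)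

definition clinear_on :: "'a::complex_vector set \<Rightarrow> ('a \<Rightarrow> 'b::complex_vector) \<Rightarrow> bool"
  where "clinear_on K A \<longleftrightarrow>
    (\<forall>x\<in>K. \<forall>y\<in>K. A (x + y) = A x + A y) \<and> (\<forall>c. \<forall>x\<in>K. A (c *\<^sub>C x) = c *\<^sub>C A x)"

definition contraction_on ::
  "'a::complex_vector set \<Rightarrow> ('a \<Rightarrow> 'a \<Rightarrow> complex) \<Rightarrow> ('a \<Rightarrow> 'a) \<Rightarrow> bool"
  where "contraction_on K ip A \<longleftrightarrow>
    clinear_on K A \<and> A ` K \<subseteq> K \<and> (\<forall>x\<in>K. ip_norm ip (A x) \<le> ip_norm ip x)"

definition isometry_on ::
  "'a::complex_vector set \<Rightarrow> ('a \<Rightarrow> 'a \<Rightarrow> complex) \<Rightarrow>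
   'b::complex_vector set \<Rightarrow> ('b \<Rightarrow> 'b \<Rightarrow> complex) \<Rightarrow> ('a \<Rightarrow> 'b) \<Rightarrow> bool"
  where "isometry_on H ipH K ipK A \<longleftrightarrow>
    clinear_on H A \<and> A ` H \<subseteq> K \<and> (\<forall>x\<in>H. ip_norm ipK (A x) = ip_norm ipH x)"

definition adjoint_on ::
  "'a::complex_vector set \<Rightarrow> ('a \<Rightarrow> 'a \<Rightarrow> complex) \<Rightarrow> ('a \<Rightarrow> 'a) \<Rightarrow> 'a \<Rightarrow> 'a"
  where "adjoint_on K ip A y = (THE w. w \<in> K \<and> (\<forall>x\<in>K. ip (A x) y = ip x w))"

abbreviation cadjoint :: "('a::chilbert_space \<Rightarrow> 'a) \<Rightarrow> 'a \<Rightarrow> 'a"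
  where "cadjoint \<equiv> adjoint_on UNIV cinner"

definition pos_op :: "('a::complex_inner \<Rightarrow> 'a) \<Rightarrow> bool"
  where "pos_op A \<longleftrightarrow> bounded_linear A \<and> clinear_on UNIV A \<and> (\<forall>x. cinner (A x) x \<in> \<real>\<^sub>\<ge>\<^sub>0)"

definition op_sqrt :: "('a::complex_inner \<Rightarrow> 'a) \<Rightarrow> 'a \<Rightarrow> 'a"
  where "op_sqrt A = (THE B. pos_op B \<and> B \<circ> B = A)"


section \<open>Tuples of \<open>q\<close>-commuting contractions\<close>

text \<open>All tuples are indexed by \<open>{1..n}\<close>; other indices are irrelevant.\<close>

definition q_commuting_contractions ::
  "nat \<Rightarrow> (nat \<Rightarrow> nat \<Rightarrow> complex) \<Rightarrow>
   'a::complex_vector set \<Rightarrow> ('a \<Rightarrow> 'a \<Rightarrow> complex) \<Rightarrow> (nat \<Rightarrow> 'a \<Rightarrow> 'a) \<Rightarrow> bool"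
  where "q_commuting_contractions n q K ip T \<longleftrightarrow>
    (\<forall>i\<in>{1..n}. contraction_on K ip (T i)) \<and>
    (\<forall>i\<in>{1..n}. \<forall>j\<in>{1..n}. \<forall>x\<in>K. T i (T j x) = q i j *\<^sub>C T j (T i x))"

definition isometric_dilation ::
  "nat \<Rightarrow> (nat \<Rightarrow> nat \<Rightarrow> complex) \<Rightarrow>
   'a::complex_vector set \<Rightarrow> ('a \<Rightarrow> 'a \<Rightarrow> complex) \<Rightarrow> (nat \<Rightarrow> 'a \<Rightarrow> 'a) \<Rightarrow>
   'b::complex_vector set \<Rightarrow> ('b \<Rightarrow> 'b \<Rightarrow> complex) \<Rightarrow> (nat \<Rightarrow> 'b \<Rightarrow> 'b) \<Rightarrow> bool"
  where "isometric_dilation n q H ipH T K ipK V \<longleftrightarrow>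
    hilbert_space_on K ipK \<and>
    q_commuting_contractions n q K ipK V \<and>
    (\<forall>m\<in>{1..n}. isometry_on K ipK K ipK (V m)) \<and>
    (\<exists>W. isometry_on H ipH K ipK W \<and>
      (\<forall>m\<in>{1..n}. \<forall>h\<in>H. W (adjoint_on H ipH (T m) h) = adjoint_on K ipK (V m) (W h)))"

definition pure_tuple :: "nat \<Rightarrow> (nat \<Rightarrow> 'a::chilbert_space \<Rightarrow> 'a) \<Rightarrow> bool"
  where "pure_tuple n T \<longleftrightarrow>
    (\<forall>i\<in>{1..n}. \<forall>h. (\<lambda>m. norm ((cadjoint (T i) ^^ m) h)) \<longlonglongrightarrow> 0)"

definition op_prod :: "(nat \<Rightarrow> 'a \<Rightarrow> 'a) \<Rightarrow> nat list \<Rightarrow> 'a \<Rightarrow> 'a"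
  where "op_prod A js = foldr (\<lambda>j B. A j \<circ> B) js id"

definition szego_inv :: "nat \<Rightarrow> (nat \<Rightarrow> 'a::chilbert_space \<Rightarrow> 'a) \<Rightarrow> 'a \<Rightarrow> 'a"
  where "szego_inv n T h =
    (\<Sum>F\<in>Pow {1..n}. (-1) ^ card F *\<^sub>C
      op_prod T (sorted_list_of_set F)
        (op_prod (\<lambda>j. cadjoint (T j)) (rev (sorted_list_of_set F)) h))"

definition adjoint_power ::
  "nat \<Rightarrow> (nat \<Rightarrow> 'a::chilbert_space \<Rightarrow> 'a) \<Rightarrow> (nat \<Rightarrow> nat) \<Rightarrow> 'a \<Rightarrow> 'a"
  where "adjoint_power n T k = op_prod (\<lambda>j. cadjoint (T j) ^^ k j) (rev [1..<Suc n])"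

definition defect_op :: "nat \<Rightarrow> (nat \<Rightarrow> 'a::chilbert_space \<Rightarrow> 'a) \<Rightarrow> 'a \<Rightarrow> 'a"
  where "defect_op n T = op_sqrt (szego_inv n T)"

definition defect_space :: "nat \<Rightarrow> (nat \<Rightarrow> 'a::chilbert_space \<Rightarrow> 'a) \<Rightarrow> 'a set"
  where "defect_space n T = closure (range (szego_inv n T))"


section \<open>The vector-valued Hardy space of the polydisc\<close>

definition polydisc :: "nat \<Rightarrow> (nat \<Rightarrow> complex) set"
  where "polydisc n = {1..n} \<rightarrow>\<^sub>E ball 0 1"

definition multi_indices :: "nat \<Rightarrow> (nat \<Rightarrow> nat) set"
  where "multi_indices n = {1..n} \<rightarrow>\<^sub>E UNIV"

text \<open>Functions on the polydisc are set to zero outside of it, so that equality of functions and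
  the pointwise vector space operations have the intended meaning.\<close>

definition power_series ::
  "nat \<Rightarrow> ((nat \<Rightarrow> nat) \<Rightarrow> 'a::complex_inner) \<Rightarrow> (nat \<Rightarrow> complex) \<Rightarrow> 'a"
  where "power_series n a z =
    (if z \<in> polydisc n
     then \<Sum>\<^sub>\<infinity>k\<in>multi_indices n. (\<Prod>i=1..n. z i ^ k i) *\<^sub>C a k
     else 0)"

definition square_summable ::
  "nat \<Rightarrow> 'a::complex_inner set \<Rightarrow> ((nat \<Rightarrow> nat) \<Rightarrow> 'a) set"
  where "square_summable n E =
    {a. (\<forall>k\<in>multi_indices n. a k \<in> E) \<and> (\<forall>k. k \<notin> multi_indices n \<longrightarrow> a k = 0) \<and>
        (\<lambda>k. (norm (a k))\<^sup>2) summable_on multi_indices n}"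

definition hardy :: "nat \<Rightarrow> 'a::complex_inner set \<Rightarrow> ((nat \<Rightarrow> complex) \<Rightarrow> 'a) set"
  where "hardy n E = power_series n ` square_summable n E"

definition hardy_coeff ::
  "nat \<Rightarrow> ((nat \<Rightarrow> complex) \<Rightarrow> 'a::complex_inner) \<Rightarrow> (nat \<Rightarrow> nat) \<Rightarrow> 'a"
  where "hardy_coeff n f = (THE a. a \<in> square_summable n UNIV \<and> power_series n a = f)"

definition hardy_inner ::
  "nat \<Rightarrow> ((nat \<Rightarrow> complex) \<Rightarrow> 'a::complex_inner) \<Rightarrow> ((nat \<Rightarrow> complex) \<Rightarrow> 'a) \<Rightarrow> complex"
  where "hardy_inner n f g =
    (\<Sum>\<^sub>\<infinity>k\<in>multi_indices n. cinner (hardy_coeff n f k) (hardy_coeff n g k))"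

definition mult_z ::
  "nat \<Rightarrow> ((nat \<Rightarrow> complex) \<Rightarrow> 'a::complex_vector) \<Rightarrow> (nat \<Rightarrow> complex) \<Rightarrow> 'a"
  where "mult_z m f = (\<lambda>z. z m *\<^sub>C f z)"

text \<open>In the following, \<open>r i j\<close> is the chosen square root of \<open>q i j\<close>.\<close>

definition rotation ::
  "nat \<Rightarrow> (nat \<Rightarrow> nat \<Rightarrow> complex) \<Rightarrow> nat \<Rightarrow>
   ((nat \<Rightarrow> complex) \<Rightarrow> 'a::complex_inner) \<Rightarrow> (nat \<Rightarrow> complex) \<Rightarrow> 'a"
  where "rotation n r m f =
    power_series n (\<lambda>k. (\<Prod>i=1..n. r m i ^ k i) *\<^sub>C hardy_coeff n f k)"

definition dilation_map ::
  "nat \<Rightarrow> (nat \<Rightarrow> nat \<Rightarrow> complex) \<Rightarrow> (nat \<Rightarrow> 'a::chilbert_space \<Rightarrow> 'a) \<Rightarrow>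
   'a \<Rightarrow> (nat \<Rightarrow> complex) \<Rightarrow> 'a"
  where "dilation_map n r T h =
    power_series n (\<lambda>k. (\<Prod>(i, j) \<in> {(i, j). 1 \<le> i \<and> i < j \<and> j \<le> n}. r i j ^ (k i * k j)) *\<^sub>C
      defect_op n T (adjoint_power n T k h))"

end

theory Submission
  imports Defs
begin

text \<open>
  For quadratic forms \<open>g\<close> on \<open>\<H>\<close> put \<open>(\<sigma>\<^sub>j g)(h) = g(T\<^sub>j\<^sup>* h)\<close>. The scalars in the relations
  between the \<open>T\<^sub>j\<^sup>*\<close> have modulus one, so the maps \<open>\<sigma>\<^sub>j\<close> commute on the forms that are invariant
  under unimodular scalars. The form \<open>\<parallel>D h\<parallel>\<^sup>2\<close> is \<open>\<Prod>\<^sub>j (1 - \<sigma>\<^sub>j)\<close> applied to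
  \<open>\<parallel>h\<parallel>\<^sup>2\<close>; summing \<open>\<parallel>D T\<^sup>*\<^sup>k h\<parallel>\<^sup>2\<close> over the box \<open>{0..<N}\<^sup>n\<close> telescopes to
  \<open>\<Prod>\<^sub>j (1 - \<sigma>\<^sub>j^N)\<close> applied to \<open>\<parallel>h\<parallel>\<^sup>2\<close>, which tends to \<open>\<parallel>h\<parallel>\<^sup>2\<close> by purity.
  The intertwining relation is a comparison of power series coefficients, where the phases agree
  because \<open>q\<^sup>1\<^sup>/\<^sup>2(i,m) q\<^sup>1\<^sup>/\<^sup>2(m,i) = 1\<close>.

  Square roots of positive operators come from the binomial series of \<open>(1 - x)\<^sup>1\<^sup>/\<^sup>2\<close>, which converges
  absolutely at \<open>x = 1\<close>. Its coefficients sum to \<open>0\<close>, which yields both the positivity of the root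
  and the inclusion of its range in the closed range of the operator.
\<close>

section \<open>Operators on complex Hilbert spaces\<close>

text \<open>Adjoint, square root and Hardy coefficients are all definite descriptions, so each must
  be shown to exist and to be unique before anything can be computed with it. For adjoints this is
  Riesz representation. For the root, uniqueness is first proved among commuting positive roots; it
  extends to all of them because a power series in an operator commutes with every bounded operator
  that commutes with that operator. For coefficients it is the identity theorem in several
  variables. The phase in the dilation leaves norms unchanged; it is dictated by the intertwining.
  Moving the adjoint of \<open>T m\<close> to its place inside the ordered product of adjoint powers
  costs a full power of \<open>q i m\<close> for each i < m and nothing for i > m, whereas the
  adjoint of the rotation contributes a square root for every i. The half powers in the phase
  balance one against the other.\<close>

lemma scaleC_minus1_left: "(-1) *\<^sub>C x = - (x::'a::complex_inner)"
  using scaleR_scaleC[of "-1" x] by simp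

lemma scaleC_zero_left [simp]: "0 *\<^sub>C x = (0::'a::complex_vector)"
  using scaleC_add_left[of 0 0 x] by simp

lemma scaleC_zero_right [simp]: "c *\<^sub>C 0 = (0::'a::complex_vector)"
  using scaleC_add_right[of c 0 "0::'a"] by simp

lemma scaleC_minus_right: "c *\<^sub>C (- x) = - (c *\<^sub>C (x::'a::complex_vector))"
  using scaleC_add_right[of c x "- x"] by (simp add: eq_neg_iff_add_eq_0 add.commute)

lemma scaleC_diff_right: "c *\<^sub>C (x - y) = c *\<^sub>C x - c *\<^sub>C (y::'a::complex_vector)"
  using scaleC_add_right[of c x "- y"] by (simp add: scaleC_minus_right)

lemma cinner_add_right: "cinner x (y + z) = cinner x y + cinner x (z::'a::complex_inner)"
  by (metis cinner_add_left cinner_commute complex_cnj_add)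

lemma cinner_scaleC_right: "cinner x (c *\<^sub>C y) = cnj c * cinner x (y::'a::complex_inner)"
  by (metis cinner_commute cinner_scaleC_left complex_cnj_mult)

lemma cinner_zero_left [simp]: "cinner 0 x = 0"
  using cinner_add_left[of 0 0 x] by simp

lemma cinner_zero_right [simp]: "cinner x 0 = 0"
  using cinner_add_right[of x 0 0] by simp

lemma cinner_minus_left: "cinner (- x) y = - cinner x y"
  using cinner_add_left[of x "- x" y] by (simp add: eq_neg_iff_add_eq_0 add.commute)

lemma cinner_minus_right: "cinner x (- y) = - cinner x y"
  using cinner_add_right[of x y "- y"] by (simp add: eq_neg_iff_add_eq_0 add.commute)

lemma cinner_diff_left: "cinner (x - y) z = cinner x z - cinner y z"
  using cinner_add_left[of x "- y" z] by (simp add: cinner_minus_left)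

lemma cinner_diff_right: "cinner x (y - z) = cinner x y - cinner x z"
  using cinner_add_right[of x y "- z"] by (simp add: cinner_minus_right)

lemma cinner_sum_left: "cinner (\<Sum>i\<in>I. f i) y = (\<Sum>i\<in>I. cinner (f i) y)"
  by (induction I rule: infinite_finite_induct) (simp_all add: cinner_add_left)

lemma cinner_self: "cinner x x = complex_of_real ((norm x)\<^sup>2)"
proof -
  have "0 \<le> Re (cinner x x)" "Im (cinner x x) = 0"
    using cinner_nonneg[of x] by (simp_all add: complex_nonneg_Reals_iff)
  then show ?thesis
    by (simp add: norm_eq_sqrt_cinner complex_eq_iff)
qed

lemma cinner_eq_zero_all:
  assumes "\<And>z. cinner z x = cinner z y"
  shows "x = y"
  using assms[of "x - y"] cinner_self[of "x - y"] by (simp add: cinner_diff_right)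

lemma norm_add_square: "(norm (x + y))\<^sup>2 = (norm x)\<^sup>2 + 2 * Re (cinner x y) + (norm y)\<^sup>2"
proof -
  have "complex_of_real ((norm (x + y))\<^sup>2) = of_real ((norm x)\<^sup>2) + cinner x y + cinner y x + of_real ((norm y)\<^sup>2)"
    unfolding cinner_self[symmetric] by (simp add: cinner_add_left cinner_add_right)
  from arg_cong[OF this, of Re] show ?thesis
    by (subst (asm) cinner_commute[of y x]) simp
qed

lemma norm_diff_square: "(norm (x - y))\<^sup>2 = (norm x)\<^sup>2 - 2 * Re (cinner x y) + (norm y)\<^sup>2"
  using norm_add_square[of x "- y"] by (simp add: cinner_minus_right)

lemma norm_scaleC [simp]: "norm (c *\<^sub>C x) = cmod c * norm (x::'a::complex_inner)"
proof -
  have "complex_of_real ((norm (c *\<^sub>C x))\<^sup>2) = c * cnj c * cinner x x"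
    unfolding cinner_self[of "c *\<^sub>C x", symmetric] by (simp add: cinner_scaleC_left cinner_scaleC_right)
  also have "\<dots> = complex_of_real ((cmod c * norm x)\<^sup>2)"
    unfolding cinner_self[of x] complex_norm_square[symmetric] by (simp add: power_mult_distrib)
  finally have "complex_of_real ((norm (c *\<^sub>C x))\<^sup>2) = complex_of_real ((cmod c * norm x)\<^sup>2)" .
  then have "(norm (c *\<^sub>C x))\<^sup>2 = (cmod c * norm x)\<^sup>2"
    using of_real_eq_iff by blast
  then show ?thesis
    by (simp add: power2_eq_iff_nonneg)
qed

text \<open>Lets the Cauchy-Schwarz proof rotate a vector so that a complex inner product becomes
  its own modulus.\<close>

lemma unimodular_multiplier:
  obtains u where "cmod u = 1" "u * z = complex_of_real (cmod z)"
proof (cases "z = 0")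
  case True
  then show ?thesis
    using that[of 1] by simp
next
  case False
  have "cnj z / cmod z * z = complex_of_real (cmod z)"
    using False by (simp add: complex_norm_square[symmetric] power2_eq_square mult.commute[of "cnj z"])
  moreover have "cmod (cnj z / cmod z) = 1"
    using False by (simp add: norm_divide)
  ultimately show ?thesis
    using that by blast
qed

lemma quadratic_nonneg_discriminant:
  fixes a b c :: real
  assumes "\<And>t. 0 \<le> a + 2 * t * b + t\<^sup>2 * c"
  shows "b\<^sup>2 \<le> a * c"
proof (cases "c = 0")
  case True
  have "b = 0"
  proof (rule ccontr)
    assume "b \<noteq> 0"
    \<comment> \<open>At this point the affine function a + 2 t b takes the value -1.\<close>
    with assms[of "- (a + 1) / (2 * b)"] True show False
      by (simp add: field_simps)
  qed
  with True show ?thesis by simp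
next
  case False
  have "0 \<le> c"
  proof (rule ccontr)
    assume neg: "\<not> 0 \<le> c"
    from assms[of 0] have "a \<ge> 0" by simp
    \<comment> \<open>The size makes \<open>t\<^sup>2 * c\<close> equal to -(a + 1), and the sign
      makes the linear term nonpositive, so the quadratic is at most -1.\<close>
    define t where "t = (if b \<ge> 0 then -1 else 1) * sqrt ((a + 1) / - c)"
    have "t\<^sup>2 = (a + 1) / - c"
      unfolding t_def power_mult_distrib using neg \<open>a \<ge> 0\<close> by (simp add: divide_nonneg_neg)
    then have "t\<^sup>2 * c = - (a + 1)"
      using neg by simp
    moreover have "t * b \<le> 0"
    proof -
      have "0 \<le> sqrt ((a + 1) / - c)"
        using neg \<open>a \<ge> 0\<close> by (simp add: divide_nonneg_neg)
      then show ?thesis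
        unfolding t_def by (auto simp: mult_nonneg_nonneg mult_nonneg_nonpos)
    qed
    ultimately show False
      using assms[of t] by (simp add: mult.assoc)
  qed
  with False have "c > 0" by simp
  \<comment> \<open>The quadratic evaluated at its minimum.\<close>
  have "0 \<le> a - b\<^sup>2 / c"
    using assms[of "- b / c"] \<open>c > 0\<close> by (simp add: field_simps power2_eq_square)
  then show ?thesis
    using \<open>c > 0\<close> by (simp add: field_simps)
qed

section \<open>Positive forms and the Cauchy-Schwarz inequality\<close>

definition selfadj :: "('a::complex_inner \<Rightarrow> 'a) \<Rightarrow> bool"
  where "selfadj A \<longleftrightarrow> (\<forall>x y. cinner (A x) y = cinner x (A y))"

text \<open>The form of \<open>A\<close> is a possibly degenerate inner product; after rotating y by
  a unimodular scalar, positivity along x + t v is a real quadratic in t. Besides \<open>A\<close>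
  the identity, the choice y = A x is the useful one: it controls the norm of A x by the form
  alone.\<close>

lemma positive_form_Cauchy_Schwarz:
  assumes lin: "clinear_on UNIV A" and sa: "selfadj A" and pos: "\<And>x. 0 \<le> Re (cinner (A x) x)"
  shows "(cmod (cinner (A x) y))\<^sup>2 \<le> Re (cinner (A x) x) * Re (cinner (A y) y)"
proof -
  obtain u where u: "cmod u = 1" "u * cinner (A x) y = complex_of_real (cmod (cinner (A x) y))"
    by (rule unimodular_multiplier)
  have add: "A (v + w) = A v + A w" and scale: "A (c *\<^sub>C v) = c *\<^sub>C A v" for v w c
    using lin by (auto simp: clinear_on_def)
  define v where "v = cnj u *\<^sub>C y"
  have uu: "cnj u * u = 1"
    using u(1) by (simp add: complex_norm_square[symmetric] mult.commute)
  have v1: "cinner (A x) v = complex_of_real (cmod (cinner (A x) y))"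
    using u(2) by (simp add: v_def cinner_scaleC_right)
  have v2: "cinner (A v) x = complex_of_real (cmod (cinner (A x) y))"
    using v1 sa cinner_commute[of "A v" x] by (simp add: selfadj_def)
  have v3: "cinner (A v) v = cinner (A y) y"
    using uu by (simp add: v_def scale cinner_scaleC_right cinner_scaleC_left mult.assoc[symmetric] mult.commute)
  have "0 \<le> Re (cinner (A x) x) + 2 * t * cmod (cinner (A x) y) + t\<^sup>2 * Re (cinner (A y) y)" for t :: real
    using pos[of "x + complex_of_real t *\<^sub>C v"]
    by (simp add: add scale cinner_add_left cinner_add_right cinner_scaleC_left cinner_scaleC_right
        v1 v2 v3 power2_eq_square algebra_simps)
  then show ?thesis
    by (rule quadratic_nonneg_discriminant)
qed

lemma cinner_Cauchy_Schwarz: "cmod (cinner x y) \<le> norm x * norm y"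
proof -
  have "(cmod (cinner x y))\<^sup>2 \<le> (norm x)\<^sup>2 * (norm y)\<^sup>2"
    using positive_form_Cauchy_Schwarz[of "\<lambda>z. z" x y]
    by (simp add: clinear_on_def selfadj_def cinner_self)
  then show ?thesis
    using power2_le_imp_le[of "cmod (cinner x y)" "norm x * norm y"] by (simp add: power_mult_distrib)
qed

section \<open>Riesz representation and adjoints of contractions\<close>

lemma bounded_linear_cinner_left: "bounded_linear (\<lambda>x::'a::complex_inner. cinner x y)"
  by (rule bounded_linear_intro[where K = "norm y"])
    (simp_all add: cinner_add_left scaleR_scaleC[where 'a = 'a] cinner_scaleC_left cinner_Cauchy_Schwarz
      scaleR_conv_of_real)

lemma bounded_linear_scaleC: "bounded_linear (\<lambda>x::'a::complex_inner. c *\<^sub>C x)"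
  by (rule bounded_linear_intro[where K = "cmod c"])
    (simp_all add: scaleC_add_right scaleR_scaleC scaleC_scaleC mult.commute)

lemma Riesz_representation:
  fixes f :: "'a::chilbert_space \<Rightarrow> complex"
  assumes add: "\<And>x y. f (x + y) = f x + f y" and scale: "\<And>c x. f (c *\<^sub>C x) = c * f x"
    and bound: "\<And>x. cmod (f x) \<le> M * norm x"
  obtains w where "\<And>x. f x = cinner x w"
proof -
  txt \<open>The representing vector minimises \<open>J\<close>; minimising sequences are Cauchy by the
    parallelogram law.\<close>
  define J where "J x = (norm x)\<^sup>2 - 2 * Re (f x)" for x
  have J_lower: "- M\<^sup>2 \<le> J x" for x
  proof -
    have "Re (f x) \<le> M * norm x"
      using bound[of x] complex_Re_le_cmod[of "f x"] by linarith
    then have "J x \<ge> (norm x - M)\<^sup>2 - M\<^sup>2"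
      by (simp add: J_def power2_eq_square algebra_simps)
    then show ?thesis
      by (smt (verit) zero_le_power2)
  qed
  define m where "m = Inf (range J)"
  have bdd: "bdd_below (range J)"
    using J_lower by (auto intro!: bdd_belowI)
  have m_le: "m \<le> J x" for x
    unfolding m_def by (rule cInf_lower[OF _ bdd]) simp
  have "\<exists>x. J x < m + 1 / real (Suc k)" for k
  proof -
    have "Inf (range J) < m + 1 / real (Suc k)"
      unfolding m_def by simp
    then show ?thesis
      using cInf_less_iff[OF _ bdd] by auto
  qed
  then obtain X where X: "\<And>k. J (X k) < m + 1 / real (Suc k)"
    by metis
  have scaleR: "f (r *\<^sub>R x) = of_real r * f x" for r x
    by (simp add: scaleR_scaleC scale)
  have par: "(norm (x - y))\<^sup>2 \<le> 2 * J x + 2 * J y - 4 * m" for x y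
  proof -
    \<comment> \<open>The midpoint competes in the infimum; this turns the parallelogram law into an
      upper bound for the distance.\<close>
    define z where "z = (1/2) *\<^sub>R (x + y)"
    have "norm z = norm (x + y) / 2"
      unfolding z_def norm_scaleR by simp
    moreover have "Re (f z) = Re (f x) / 2 + Re (f y) / 2"
      unfolding z_def scaleR add by (simp add: add_divide_distrib)
    ultimately have "4 * J z = (norm (x + y))\<^sup>2 - 4 * Re (f x) - 4 * Re (f y)"
      by (simp add: J_def power_divide del: eq_divide_eq_numeral1)
    moreover have "(norm (x - y))\<^sup>2 + (norm (x + y))\<^sup>2 = 2 * (norm x)\<^sup>2 + 2 * (norm y)\<^sup>2"
      by (simp add: norm_add_square norm_diff_square)
    ultimately have "(norm (x - y))\<^sup>2 = 2 * J x + 2 * J y - 4 * J z"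
      by (simp add: J_def)
    with m_le[of z] show ?thesis
      by linarith
  qed
  have "Cauchy X"
  proof (rule metric_CauchyI)
    fix e :: real
    assume "e > 0"
    \<comment> \<open>From here on \<open>J\<close> stays within \<open>e\<^sup>2 / 4\<close> of its
      infimum, and \<open>par\<close> adds four such errors.\<close>
    then obtain N where N: "4 / e\<^sup>2 < real N"
      using reals_Archimedean2 by blast
    have "N > 0"
      using N \<open>e > 0\<close> by (metis gr0I less_asym' of_nat_0 divide_pos_pos zero_less_numeral zero_less_power)
    have small: "4 * J (X k) < 4 * m + e\<^sup>2" if "k \<ge> N" for k
    proof -
      have "4 / e\<^sup>2 < real (Suc k)"
        using N that by linarith
      then have "1 / real (Suc k) < e\<^sup>2 / 4"
        using \<open>e > 0\<close> by (simp add: field_simps)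
      then have "4 * (1 / real (Suc k)) < e\<^sup>2"
        by simp
      then show ?thesis
        using X[of k] by linarith
    qed
    have "dist (X i) (X j) < e" if "i \<ge> N" "j \<ge> N" for i j
    proof -
      have "(norm (X i - X j))\<^sup>2 < e\<^sup>2"
        using par[of "X i" "X j"] small[OF that(1)] small[OF that(2)] by linarith
      then show ?thesis
        using \<open>e > 0\<close> by (simp add: dist_norm power2_less_imp_less)
    qed
    then show "\<exists>N. \<forall>i\<ge>N. \<forall>j\<ge>N. dist (X i) (X j) < e"
      by blast
  qed
  then obtain w where w: "X \<longlonglongrightarrow> w"
    using Cauchy_convergent convergent_def by blast
  have blin: "bounded_linear f"
    by (rule bounded_linear_intro[where K = M])
      (use bound in \<open>simp_all add: add scaleR scaleR_conv_of_real mult.commute\<close>)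
  have "(\<lambda>k. J (X k)) \<longlonglongrightarrow> J w"
    unfolding J_def by (intro tendsto_intros w bounded_linear.tendsto[OF blin])
  moreover have "(\<lambda>k. J (X k)) \<longlonglongrightarrow> m"
  proof (rule tendsto_sandwich[of "\<lambda>_. m"])
    show "(\<lambda>k. m + 1 / real (Suc k)) \<longlonglongrightarrow> m"
      using tendsto_add[OF tendsto_const LIMSEQ_inverse_real_of_nat, of m] by (simp add: inverse_eq_divide)
  qed (use m_le less_imp_le[OF X] in \<open>auto intro!: always_eventually simp del: of_nat_Suc\<close>)
  ultimately have Jw: "J w = m"
    using LIMSEQ_unique by blast
  have Re_eq: "Re (f x) = Re (cinner x w)" for x
  proof -
    \<comment> \<open>First variation at the minimiser: the constant term is zero, so the
      discriminant bound forces the linear coefficient to vanish.\<close>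
    have "0 \<le> 0 + 2 * t * Re (cinner w x - f x) + t\<^sup>2 * (norm x)\<^sup>2" for t :: real
    proof -
      have "m \<le> J (w + t *\<^sub>R x)"
        by (rule m_le)
      also have "\<dots> = J w + 2 * t * Re (cinner w x - f x) + t\<^sup>2 * (norm x)\<^sup>2"
        unfolding J_def norm_add_square
        by (simp add: add scaleR scaleR_scaleC cinner_scaleC_right power_mult_distrib scale algebra_simps)
      finally show ?thesis
        using Jw by simp
    qed
    from quadratic_nonneg_discriminant[OF this] show ?thesis
      by (subst cinner_commute) simp
  qed
  have "f x = cinner x w" for x
  proof (rule complex_eqI)
    show "Re (f x) = Re (cinner x w)"
      by (rule Re_eq)
    show "Im (f x) = Im (cinner x w)"
      \<comment> \<open>The imaginary part at x is minus the real part at i x.\<close>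
      using Re_eq[of "\<i> *\<^sub>C x"] by (simp add: scale cinner_scaleC_left)
  qed
  with that show ?thesis by blast
qed

text \<open>Uniqueness in the definite description: two candidates have the same inner product with
  every vector of \<open>K\<close>, in particular with their difference. That difference is written
  as v + (-1) w because the locale laws speak of sums and scalar multiples.\<close>

lemma adjoint_on_eqI:
  assumes "hilbert_space_on K ip" "w \<in> K" "\<And>x. x \<in> K \<Longrightarrow> ip (A x) y = ip x w"
  shows "adjoint_on K ip A y = w"
  unfolding adjoint_on_def
proof (rule the_equality)
  interpret hilbert_space_on K ip by fact
  fix v
  assume v: "v \<in> K \<and> (\<forall>x\<in>K. ip (A x) y = ip x v)"
  define d where "d = v + (-1) *\<^sub>C w"
  have sum0: "(-1) *\<^sub>C w + w = 0"
    using scaleC_add_left[of "-1" 1 w] by (simp add: scaleC_one)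
  have "d \<in> K" "(-1) *\<^sub>C w \<in> K"
    using v assms(2) by (simp_all add: d_def add_mem scale_mem)
  have "ip d v = ip d w"
    using v assms(3) \<open>d \<in> K\<close> by simp
  then have "ip v d = ip w d"
    using ip_commute v assms(2) \<open>d \<in> K\<close> by metis
  then have "ip d d = 0"
    using ip_add_left[of v "(-1) *\<^sub>C w" d] ip_scale_left[of w d "-1"] v assms(2) \<open>d \<in> K\<close>
      \<open>(-1) *\<^sub>C w \<in> K\<close> by (simp add: d_def)
  then have "d = 0"
    using ip_definite \<open>d \<in> K\<close> by blast
  then show "v = w"
    using sum0 unfolding d_def by (metis add.assoc add.right_neutral add_left_cancel add.commute)
qed (use assms in blast)

lemma clinear_onD:
  assumes "clinear_on UNIV A"
  shows "A (x + y) = A x + A y" "A (c *\<^sub>C x) = c *\<^sub>C A x"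
  using assms by (simp_all add: clinear_on_def)

lemma clinear_on_diff:
  fixes A :: "'a::complex_inner \<Rightarrow> 'b::complex_inner"
  assumes "clinear_on UNIV A"
  shows "A (x - y) = A x - A y"
  using clinear_onD(1)[OF assms, of x "(-1) *\<^sub>C y"] clinear_onD(2)[OF assms, of "-1" y]
  by (simp add: scaleC_minus1_left)

lemma cadjoint_contraction:
  fixes A :: "'a::chilbert_space \<Rightarrow> 'a"
  assumes "contraction_on UNIV cinner A"
  shows "cinner (A x) y = cinner x (cadjoint A y)"
proof -
  have lin: "clinear_on UNIV A" and bd: "norm (A x) \<le> norm x" for x
    using assms by (auto simp: contraction_on_def)
  obtain w where w: "\<And>x. cinner (A x) y = cinner x w"
  proof (rule Riesz_representation[of "\<lambda>x. cinner (A x) y" "norm y"])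
    show "cmod (cinner (A x) y) \<le> norm y * norm x" for x
      using cinner_Cauchy_Schwarz[of "A x" y] mult_right_mono[OF bd[of x], of "norm y"]
      by (simp add: mult.commute)
  qed (simp_all add: clinear_onD[OF lin] cinner_add_left cinner_scaleC_left)
  have "cadjoint A y = w"
    using w by (intro adjoint_on_eqI hilbert_space_on_UNIV) auto
  with w show ?thesis by simp
qed

lemma cadjoint_contraction_clinear:
  assumes "contraction_on UNIV cinner A"
  shows "clinear_on UNIV (cadjoint A)"
  unfolding clinear_on_def
proof (intro conjI ballI allI)
  show "cadjoint A (x + y) = cadjoint A x + cadjoint A y" for x y
    by (rule cinner_eq_zero_all) (simp add: cadjoint_contraction[OF assms, symmetric] cinner_add_right)
  show "cadjoint A (c *\<^sub>C x) = c *\<^sub>C cadjoint A x" for c x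
    by (rule cinner_eq_zero_all) (simp add: cadjoint_contraction[OF assms, symmetric] cinner_scaleC_right)
qed

text \<open>The square of the norm of the adjoint at x is the inner product of A applied to that
  vector with x; Cauchy-Schwarz and contractivity then let one factor cancel.\<close>

lemma norm_cadjoint_le:
  assumes "contraction_on UNIV cinner A"
  shows "norm (cadjoint A x) \<le> norm x"
proof -
  let ?y = "cadjoint A x"
  have "(norm ?y)\<^sup>2 = Re (cinner (A ?y) x)"
    by (simp add: cadjoint_contraction[OF assms] cinner_self)
  also have "\<dots> \<le> norm (A ?y) * norm x"
    using complex_Re_le_cmod cinner_Cauchy_Schwarz order_trans by blast
  also have "\<dots> \<le> norm ?y * norm x"
    using assms by (intro mult_right_mono) (auto simp: contraction_on_def)
  finally show ?thesis
    by (cases "?y = 0") (simp_all add: power2_eq_square)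
qed

section \<open>The square root of a positive operator\<close>

instance chilbert_space \<subseteq> banach ..

text \<open>Polarization: \<open>pos_op\<close> only says that the form is real and nonnegative, and
  over the complex numbers reality at x + y and at x + i y already determines the symmetry.\<close>

lemma pos_op_selfadj:
  assumes "pos_op A"
  shows "selfadj A"
  unfolding selfadj_def
proof (intro allI)
  fix x y
  have lin: "A (v + w) = A v + A w" "A (c *\<^sub>C v) = c *\<^sub>C A v" for v w c
    using assms by (auto simp: pos_op_def clinear_on_def)
  have im: "Im (cinner (A v) v) = 0" for v
    using assms by (simp add: pos_op_def complex_nonneg_Reals_iff)
  have "Im (cinner (A x) y) + Im (cinner (A y) x) = 0"
    using im[of "x + y"] im[of x] im[of y] by (simp add: lin cinner_add_left cinner_add_right)
  moreover have "Re (cinner (A y) x) = Re (cinner (A x) y)"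
    using im[of "x + \<i> *\<^sub>C y"] im[of x] im[of y]
    by (simp add: lin cinner_add_left cinner_add_right cinner_scaleC_left cinner_scaleC_right)
  ultimately have "cinner (A x) y = cnj (cinner (A y) x)"
    by (simp add: complex_eq_iff)
  then show "cinner (A x) y = cinner x (A y)"
    by (subst cinner_commute)
qed

text \<open>Cauchy-Schwarz for the form with y = A x bounds the fourth power of the norm of A x by
  zero.\<close>

lemma pos_op_zero_form:
  assumes "pos_op A" "Re (cinner (A x) x) = 0"
  shows "A x = 0"
proof -
  have "(cmod (cinner (A x) (A x)))\<^sup>2 \<le> Re (cinner (A x) x) * Re (cinner (A (A x)) (A x))"
    using assms(1) pos_op_selfadj[OF assms(1)]
    by (intro positive_form_Cauchy_Schwarz) (auto simp: pos_op_def complex_nonneg_Reals_iff)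
  then show ?thesis
    using assms(2) by (simp add: cinner_self)
qed

section \<open>Coefficients of the binomial series for the square root of 1 - x\<close>

definition root_coeff :: "nat \<Rightarrow> real"
  where "root_coeff k = (1/2 gchoose k) * (-1) ^ k"

lemma gbinomial_Suc_right:
  "(a gchoose Suc k) = (a - of_nat k) / of_nat (Suc k) * (a gchoose k :: real)"
proof -
  have "a * (a gchoose k) = of_nat k * (a gchoose k) + of_nat (Suc k) * (a gchoose Suc k)"
    by (rule gbinomial_mult_1)
  then have "of_nat (Suc k) * (a gchoose Suc k) = (a - of_nat k) * (a gchoose k)"
    by (simp only: left_diff_distrib)
  then show ?thesis
    by (simp add: nonzero_eq_divide_eq del: of_nat_Suc) (simp add: mult.commute)
qed

lemma root_coeff_0 [simp]: "root_coeff 0 = 1"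
  by (simp add: root_coeff_def)

text \<open>Successive coefficients have a positive ratio, so all of them inherit the sign of the
  first-order coefficient -1/2.\<close>

lemma root_coeff_nonpos: "root_coeff (Suc k) \<le> 0"
proof (induction k)
  case 0
  then show ?case by (simp add: root_coeff_def)
next
  case (Suc k)
  have "root_coeff (Suc (Suc k)) = root_coeff (Suc k) * ((real (Suc k) - 1/2) / real (Suc (Suc k)))"
    unfolding root_coeff_def by (subst gbinomial_Suc_right) (simp add: field_simps)
  then show ?case
    using mult_nonpos_nonneg[OF Suc, of "(real (Suc k) - 1/2) / real (Suc (Suc k))"] by simp
qed

text \<open>The partial sums have a closed form, the coefficients of the series for exponent -1/2 up
  to the sign (-1)^m, and these have positive successive ratios.\<close>

lemma sum_root_coeff_nonneg: "0 \<le> (\<Sum>k\<le>m. root_coeff k)"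
proof -
  have "0 \<le> (-1) ^ m * (-1/2 gchoose m :: real)"
  proof (induction m)
    case (Suc m)
    have "(-1) ^ Suc m * (-1/2 gchoose Suc m :: real)
        = ((-1) ^ m * (-1/2 gchoose m)) * ((real m + 1/2) / real (Suc m))"
      by (subst gbinomial_Suc_right) (simp add: field_simps)
    with Suc show ?case
      by (simp only:) simp
  qed simp
  then show ?thesis
    using gbinomial_sum_lower_neg[of "1/2::real" m] by (simp add: root_coeff_def)
qed

text \<open>The signs are one +1 followed by nonpositive terms, so the absolute partial sum is 2
  minus the plain one. Its nonnegativity gives the bound 2 without any asymptotics.\<close>

lemma summable_abs_root_coeff: "summable (\<lambda>k. \<bar>root_coeff k\<bar>)"
proof (rule bounded_imp_summable[where B = 2])
  fix m
  have "(\<Sum>k\<le>m. \<bar>root_coeff k\<bar>) = 2 - (\<Sum>k\<le>m. root_coeff k)"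
    by (induction m) (use root_coeff_nonpos in \<open>simp_all add: abs_of_nonpos\<close>)
  then show "(\<Sum>k\<le>m. \<bar>root_coeff k\<bar>) \<le> 2"
    using sum_root_coeff_nonneg[of m] by simp
qed simp

text \<open>Vandermonde: the series squares to 1 - x, coefficient by coefficient.\<close>

lemma root_coeff_convolution:
  "(\<Sum>i\<le>m. root_coeff i * root_coeff (m - i)) = (if m = 0 then 1 else if m = 1 then -1 else 0)"
proof -
  have "(\<Sum>i\<le>m. root_coeff i * root_coeff (m - i))
      = (\<Sum>i\<le>m. (1/2 gchoose i) * (1/2 gchoose (m - i)) * (-1) ^ m)"
    by (intro sum.cong) (auto simp: root_coeff_def mult_ac simp flip: power_add)
  also have "\<dots> = (1 gchoose m) * (-1) ^ m"
    using gbinomial_Vandermonde[of "1/2::real" "1/2" m]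
    by (simp add: atLeast0AtMost flip: sum_distrib_right)
  also have "(1::real) gchoose m = of_nat (1 choose m)"
    using binomial_gbinomial[of 1 m, where 'a = real] by simp
  also have "of_nat (1 choose m) * (-1) ^ m = (if m = 0 then 1 else if m = 1 then -1 else (0::real))"
    by (auto simp: binomial_eq_0)
  finally show ?thesis .
qed

text \<open>By the Cauchy product the square of the sum is 1 - 1 = 0, which settles the value at the
  boundary point x = 1 directly.\<close>

lemma root_coeff_sums: "root_coeff sums 0"
proof -
  have s: "summable root_coeff"
    using summable_abs_root_coeff by (rule summable_rabs_cancel)
  have "(\<lambda>m. \<Sum>i\<le>m. root_coeff i * root_coeff (m - i)) sums ((\<Sum>k. root_coeff k) * (\<Sum>k. root_coeff k))"
    using summable_abs_root_coeff by (intro Cauchy_product_sums) auto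
  moreover have "(\<lambda>m. \<Sum>i\<le>m. root_coeff i * root_coeff (m - i)) sums (\<Sum>m\<in>{0, 1::nat}. if m = 0 then 1 else if m = 1 then -1 else 0)"
    unfolding root_coeff_convolution by (rule sums_finite[of "{0, 1}"]) auto
  ultimately have "(\<Sum>k. root_coeff k) = 0"
    using sums_unique2 by fastforce
  with s show ?thesis
    by (metis summable_sums)
qed

section \<open>The square root of 1 - X for a linear contraction X\<close>

definition root_series :: "('a::chilbert_space \<Rightarrow> 'a) \<Rightarrow> 'a \<Rightarrow> 'a"
  where "root_series X x = (\<Sum>k. root_coeff k *\<^sub>R (X ^^ k) x)"

context
  fixes X :: "'a::chilbert_space \<Rightarrow> 'a"
  assumes lin: "clinear_on UNIV X" and contr: "\<And>x. norm (X x) \<le> norm x"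
begin

lemma funpow_clinear: "clinear_on UNIV (X ^^ k)"
  by (induction k) (use lin in \<open>auto simp: clinear_on_def\<close>)

lemma norm_funpow_le: "norm ((X ^^ k) x) \<le> norm x"
proof (induction k)
  case (Suc k)
  then show ?case
    using order_trans[OF contr[of "(X ^^ k) x"]] by simp
qed simp

lemma summable_norm_root_series: "summable (\<lambda>k. norm (root_coeff k *\<^sub>R (X ^^ k) x))"
proof (rule summable_comparison_test')
  show "summable (\<lambda>k. \<bar>root_coeff k\<bar> * norm x)"
    by (intro summable_mult2 summable_abs_root_coeff)
qed (simp add: mult_left_mono norm_funpow_le)

lemma root_series_sums: "(\<lambda>k. root_coeff k *\<^sub>R (X ^^ k) x) sums root_series X x"
  unfolding root_series_def by (rule summable_sums[OF summable_norm_cancel[OF summable_norm_root_series]])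

lemma root_series_clinear: "clinear_on UNIV (root_series X)"
  unfolding clinear_on_def
proof (intro conjI ballI allI)
  fix x y :: 'a and c
  have "(\<lambda>k. root_coeff k *\<^sub>R (X ^^ k) (x + y)) sums (root_series X x + root_series X y)"
    using sums_add[OF root_series_sums root_series_sums]
    by (simp add: clinear_onD[OF funpow_clinear] scaleR_add_right)
  then show "root_series X (x + y) = root_series X x + root_series X y"
    using root_series_sums sums_unique2 by blast
  have "(\<lambda>k. root_coeff k *\<^sub>R (X ^^ k) (c *\<^sub>C x)) sums (c *\<^sub>C root_series X x)"
    using bounded_linear.sums[OF bounded_linear_scaleC root_series_sums]
    by (simp add: clinear_onD[OF funpow_clinear] scaleR_scaleC scaleC_scaleC mult.commute)
  then show "root_series X (c *\<^sub>C x) = c *\<^sub>C root_series X x"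
    using root_series_sums sums_unique2 by blast
qed

lemma root_series_bounded_linear: "bounded_linear (root_series X)"
proof (rule bounded_linear_intro)
  show "norm (root_series X x) \<le> norm x * (\<Sum>k. \<bar>root_coeff k\<bar>)" for x
  proof -
    have "norm (root_series X x) \<le> (\<Sum>k. norm (root_coeff k *\<^sub>R (X ^^ k) x))"
      unfolding root_series_def by (rule summable_norm[OF summable_norm_root_series])
    also have "\<dots> \<le> (\<Sum>k. \<bar>root_coeff k\<bar> * norm x)"
      by (intro suminf_le summable_norm_root_series summable_mult2 summable_abs_root_coeff)
        (simp add: mult_left_mono norm_funpow_le)
    also have "\<dots> = norm x * (\<Sum>k. \<bar>root_coeff k\<bar>)"
      using suminf_mult[OF summable_abs_root_coeff, of "norm x"] by (simp add: mult.commute)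
    finally show ?thesis .
  qed
qed (simp_all add: clinear_onD[OF root_series_clinear] scaleR_scaleC)

text \<open>This is what later makes an arbitrary positive root commute with the constructed
  one.\<close>

lemma root_series_commute:
  assumes "bounded_linear C" "\<And>x. C (X x) = X (C x)"
  shows "C (root_series X x) = root_series X (C x)"
proof -
  have "C ((X ^^ k) x) = (X ^^ k) (C x)" for k
    by (induction k) (simp_all add: assms(2))
  then have "(\<lambda>k. root_coeff k *\<^sub>R (X ^^ k) (C x)) sums C (root_series X x)"
    using bounded_linear.sums[OF assms(1) root_series_sums, of x]
    by (simp add: linear_cmul[OF bounded_linear.linear[OF assms(1)]])
  then show ?thesis
    using root_series_sums sums_unique2 by blast
qed

text \<open>One absolutely summable double family, evaluated twice: summed by rows it gives the
  iterated series, summed along antidiagonals the convolution identity leaves only degrees 0 and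
  1.\<close>

lemma root_series_root_series: "root_series X (root_series X x) = x - X x"
proof -
  define f where "f p = (root_coeff (fst p) * root_coeff (snd p)) *\<^sub>R (X ^^ (fst p + snd p)) x" for p
  have has1: "((\<lambda>k. root_coeff k *\<^sub>R (X ^^ k) y) has_sum root_series X y) UNIV" for y
    using norm_summable_imp_has_sum[OF summable_norm_root_series root_series_sums] .
  have inner: "((\<lambda>k. f (j, k)) has_sum root_coeff j *\<^sub>R (X ^^ j) (root_series X x)) UNIV" for j
  proof -
    have bl: "bounded_linear (X ^^ j)"
      by (rule bounded_linear_intro[where K = 1])
        (simp_all add: clinear_onD[OF funpow_clinear] scaleR_scaleC norm_funpow_le)
    from has_sum_bounded_linear[OF bounded_linear_compose[OF bounded_linear_scaleR_right bl] has1]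
    show ?thesis
      by (simp add: f_def linear_cmul[OF bounded_linear.linear[OF bl]] funpow_add)
  qed
  have "(\<lambda>k. \<bar>root_coeff k\<bar>) summable_on UNIV"
    using summable_abs_root_coeff by (simp add: summable_on_UNIV_nonneg_real_iff)
  then have abs: "(\<lambda>k. norm (root_coeff k)) summable_on UNIV"
    by simp
  have "(\<lambda>p. norm (root_coeff (fst p) * root_coeff (snd p))) summable_on UNIV \<times> UNIV"
    unfolding Infinite_Sum.abs_summable_on_Sigma_iff
    using abs by (auto simp: abs_mult infsum_cmult_right' intro!: summable_on_cmult_right summable_on_cmult_left)
  then have "(\<lambda>p. \<bar>root_coeff (fst p) * root_coeff (snd p)\<bar> * norm x) summable_on UNIV \<times> UNIV"
    by (intro summable_on_cmult_left) simp
  then have "(\<lambda>p. norm (f p)) summable_on UNIV \<times> UNIV"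
    by (rule Infinite_Sum.abs_summable_on_comparison_test')
      (simp add: f_def mult_left_mono norm_funpow_le)
  then have "f summable_on UNIV \<times> UNIV"
    by (rule abs_summable_summable)
  then have f1: "(f has_sum root_series X (root_series X x)) (UNIV \<times> UNIV)"
    using has_sum_SigmaI[OF inner has1] by blast
  moreover have "(f has_sum (x - X x)) (UNIV \<times> UNIV)"
  proof -
    \<comment> \<open>The first component of p is the total degree, the second the exponent of the
      outer factor.\<close>
    define g where "g p = f (snd p, fst p - snd p)" for p
    have "((\<lambda>p. g p) has_sum root_series X (root_series X x)) (Sigma UNIV (\<lambda>m. {..m}))"
    proof (subst has_sum_reindex_bij_witness[where T = "UNIV \<times> UNIV" and h = f
          and j = "\<lambda>p. (snd p, fst p - snd p)" and i = "\<lambda>p. (fst p + snd p, fst p)"])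
    qed (use f1 in \<open>auto simp: g_def\<close>)
    moreover have "((\<lambda>i. g (m, i)) has_sum (if m = 0 then x else if m = 1 then - X x else 0)) {..m}" for m
    proof -
      have "(\<Sum>i\<le>m. g (m, i)) = (\<Sum>i\<le>m. root_coeff i * root_coeff (m - i)) *\<^sub>R (X ^^ m) x"
        unfolding scaleR_sum_left by (intro sum.cong) (auto simp: g_def f_def)
      then show ?thesis
        unfolding root_coeff_convolution by (auto intro!: has_sum_finiteI)
    qed
    ultimately have "((\<lambda>m::nat. if m = 0 then x else if m = 1 then - X x else 0) has_sum root_series X (root_series X x)) UNIV"
      by (rule has_sum_SigmaD)
    moreover have "((\<lambda>m::nat. if m = 0 then x else if m = 1 then - X x else 0) has_sum (x - X x)) UNIV"
      by (rule has_sum_finite_neutralI[of "{0, 1}"]) auto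
    ultimately have "root_series X (root_series X x) = x - X x"
      by (rule has_sum_unique)
    with f1 show ?thesis by simp
  qed
  ultimately show ?thesis
    by (rule has_sum_unique)
qed

text \<open>Since the coefficients sum to 0, x may be subtracted from every term; each power of X at
  x differs from x by an element of the range of 1 - X, by telescoping.\<close>

lemma root_series_closure: "root_series X x \<in> closure (range (\<lambda>y. y - X y))"
proof -
  let ?R = "range (\<lambda>y. y - X y)"
  have R_add: "u + v \<in> ?R" if uv: "u \<in> ?R" "v \<in> ?R" for u v
  proof -
    obtain a b where "u = a - X a" "v = b - X b"
      using uv by blast
    then have "u + v = (a + b) - X (a + b)"
      by (simp add: clinear_onD[OF lin])
    then show ?thesis by blast
  qed
  have R_scale: "r *\<^sub>R u \<in> ?R" if "u \<in> ?R" for r u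
  proof -
    obtain a where "u = a - X a"
      using \<open>u \<in> ?R\<close> by blast
    then have "r *\<^sub>R u = r *\<^sub>R a - X (r *\<^sub>R a)"
      by (simp add: clinear_onD[OF lin] scaleR_scaleC scaleC_diff_right)
    then show ?thesis by blast
  qed
  have R_zero: "0 \<in> ?R"
    using R_scale[of "0 - X 0" 0] by (metis rangeI scaleR_zero_left)
  have pow: "(X ^^ k) x - x \<in> ?R" for k
  proof (induction k)
    case (Suc k)
    have "(-1) *\<^sub>R ((X ^^ k) x - X ((X ^^ k) x)) \<in> ?R"
      by (rule R_scale) blast
    from R_add[OF Suc this] show ?case by simp
  qed (use R_zero in simp)
  have "(\<lambda>m. \<Sum>k<m. root_coeff k *\<^sub>R ((X ^^ k) x - x)) \<longlonglongrightarrow> root_series X x - 0 *\<^sub>R x"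
    using sums_diff[OF root_series_sums[of x] bounded_linear.sums[OF bounded_linear_scaleR_left[of x] root_coeff_sums]]
    by (simp add: sums_def scaleR_diff_right)
  moreover have "(\<Sum>k<m. root_coeff k *\<^sub>R ((X ^^ k) x - x)) \<in> ?R" for m
    by (induction m) (use R_zero R_add R_scale pow in auto)
  ultimately show ?thesis
    unfolding closure_sequential by force
qed

text \<open>Replacing the form of each power of X by its upper bound, the squared norm of x, lowers
  every term of positive degree, since its coefficient is nonpositive, and changes nothing in degree
  0. The lowered series sums to 0.\<close>

lemma root_series_pos:
  assumes "selfadj X"
  shows "pos_op (root_series X)"
  unfolding pos_op_def
proof (intro conjI allI root_series_bounded_linear root_series_clinear)
  fix x
  have sa: "cinner ((X ^^ k) y) z = cinner y ((X ^^ k) z)" for k y z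
  proof (induction k arbitrary: y z)
    case (Suc k)
    then show ?case
      using assms by (simp add: selfadj_def funpow_swap1)
  qed simp
  have im: "Im (cinner ((X ^^ k) x) x) = 0" for k
    using sa[of k x x] cinner_commute[of "(X ^^ k) x" x] by (simp add: complex_eq_iff)
  have s: "(\<lambda>k. root_coeff k *\<^sub>R cinner ((X ^^ k) x) x) sums cinner (root_series X x) x"
    using bounded_linear.sums[OF bounded_linear_cinner_left root_series_sums, of x]
    by (simp add: scaleR_scaleC[where 'a = 'a] cinner_scaleC_left scaleR_conv_of_real)
  have "(\<lambda>k. 0) sums Im (cinner (root_series X x) x)"
    using sums_Im[OF s] by (simp add: im)
  then have "Im (cinner (root_series X x) x) = 0"
    using sums_unique2 sums_zero by blast
  moreover have "0 \<le> Re (cinner (root_series X x) x)"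
  proof -
    have s0: "(\<lambda>k. root_coeff k * (norm x)\<^sup>2) sums 0"
      using sums_mult2[OF root_coeff_sums] by simp
    have s1: "(\<lambda>k. root_coeff k * Re (cinner ((X ^^ k) x) x)) sums Re (cinner (root_series X x) x)"
      using sums_Re[OF s] by simp
    have le: "root_coeff k * (norm x)\<^sup>2 \<le> root_coeff k * Re (cinner ((X ^^ k) x) x)" for k
    proof (cases k)
      case (Suc j)
      have "Re (cinner ((X ^^ k) x) x) \<le> norm ((X ^^ k) x) * norm x"
        using complex_Re_le_cmod cinner_Cauchy_Schwarz order_trans by blast
      also have "\<dots> \<le> (norm x)\<^sup>2"
        using norm_funpow_le[of k x] by (simp add: power2_eq_square mult_right_mono)
      finally show ?thesis
        using root_coeff_nonpos[of j] Suc by (simp add: mult_left_mono_neg)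
    qed (simp add: cinner_self)
    show ?thesis
      by (rule sums_le[OF le s0 s1])
  qed
  ultimately show "cinner (root_series X x) x \<in> \<real>\<^sub>\<ge>\<^sub>0"
    by (simp add: complex_nonneg_Reals_iff)
qed

end

lemma pos_op_sqrt_exists:
  fixes A :: "'a::chilbert_space \<Rightarrow> 'a"
  assumes A: "pos_op A"
  obtains B where "pos_op B" "\<And>x. B (B x) = A x" "\<And>x. B x \<in> closure (range A)"
    "\<And>C x. bounded_linear C \<Longrightarrow> (\<And>x. C (A x) = A (C x)) \<Longrightarrow> C (B x) = B (C x)"
proof -
  have lin: "clinear_on UNIV A" and bl: "bounded_linear A" and pos: "0 \<le> Re (cinner (A x) x)" for x
    using A by (auto simp: pos_op_def complex_nonneg_Reals_iff)
  obtain c where c: "c > 0" "\<And>x. norm (A x) \<le> norm x * c"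
    using bounded_linear.pos_bounded[OF bl] by blast
  \<comment> \<open>Dividing by a norm bound brings the form of A/c below that of the identity, so X
    is positive and A is c times 1 - X.\<close>
  define X where "X x = x - (1/c) *\<^sub>R A x" for x
  have linX: "clinear_on UNIV X"
    using lin by (auto simp: clinear_on_def X_def scaleC_diff_right scaleR_scaleC scaleC_scaleC
        scaleC_add_right mult.commute)
  have saX: "selfadj X"
    using pos_op_selfadj[OF A] by (simp add: selfadj_def X_def cinner_diff_left cinner_diff_right
        scaleR_scaleC cinner_scaleC_left cinner_scaleC_right)
  have formX: "Re (cinner (X x) x) = (norm x)\<^sup>2 - Re (cinner (A x) x) / c" for x
    by (simp add: X_def cinner_diff_left scaleR_scaleC cinner_scaleC_left cinner_self)
  have posX: "0 \<le> Re (cinner (X x) x)" for x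
  proof -
    have "Re (cinner (A x) x) \<le> norm (A x) * norm x"
      using complex_Re_le_cmod cinner_Cauchy_Schwarz order_trans by blast
    also have "\<dots> \<le> c * (norm x)\<^sup>2"
      using mult_right_mono[OF c(2)[of x], of "norm x"] by (simp add: power2_eq_square mult_ac)
    finally show ?thesis
      unfolding formX using c(1) by (simp add: divide_le_eq mult.commute)
  qed
  have leX: "Re (cinner (X x) x) \<le> (norm x)\<^sup>2" for x
    unfolding formX using pos[of x] c(1) by simp
  have contrX: "norm (X x) \<le> norm x" for x
  proof -
    \<comment> \<open>Cauchy-Schwarz for the form of X at the pair x, X x; together with
      \<open>leX\<close> it leaves one factor to cancel.\<close>
    have "((norm (X x))\<^sup>2)\<^sup>2 \<le> Re (cinner (X x) x) * Re (cinner (X (X x)) (X x))"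
      using positive_form_Cauchy_Schwarz[OF linX saX posX, of x "X x"]
      by (simp add: cinner_self norm_power)
    also have "\<dots> \<le> (norm x)\<^sup>2 * (norm (X x))\<^sup>2"
      by (intro mult_mono leX posX) simp
    finally have "(norm (X x))\<^sup>2 * (norm (X x))\<^sup>2 \<le> (norm x)\<^sup>2 * (norm (X x))\<^sup>2"
      by (simp add: power2_eq_square)
    then have "(norm (X x))\<^sup>2 \<le> (norm x)\<^sup>2 \<or> X x = 0"
      by (metis mult_le_cancel_right_pos zero_less_norm_iff zero_less_power)
    then show ?thesis
      using power2_le_imp_le by fastforce
  qed
  define S where "S = root_series X"
  define B where "B x = sqrt c *\<^sub>R S x" for x
  have S: "pos_op S" "clinear_on UNIV S" "bounded_linear S"
    using root_series_pos[OF linX contrX saX] by (simp_all add: S_def pos_op_def)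
  have "pos_op B"
    unfolding pos_op_def
  proof (intro conjI allI)
    show "bounded_linear B"
      unfolding B_def by (intro bounded_linear_intros S)
    show "clinear_on UNIV B"
      using S(2) by (simp add: clinear_on_def B_def scaleC_add_right scaleR_scaleC scaleC_scaleC mult.commute)
    show "cinner (B x) x \<in> \<real>\<^sub>\<ge>\<^sub>0" for x
      using S(1) c(1) by (simp add: pos_op_def B_def scaleR_scaleC cinner_scaleC_left complex_nonneg_Reals_iff)
  qed
  moreover have "B (B x) = A x" for x
  proof -
    have "B (B x) = c *\<^sub>R S (S x)"
      using c(1) by (simp add: B_def scaleR_scaleC clinear_onD[OF S(2)] scaleC_scaleC flip: of_real_mult)
    also have "S (S x) = (1/c) *\<^sub>R A x"
      unfolding S_def root_series_root_series[OF linX contrX] by (simp add: X_def)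
    finally show ?thesis
      using c(1) by simp
  qed
  moreover have "B x \<in> closure (range A)" for x
  proof -
    have sub: "range (\<lambda>y. y - X y) \<subseteq> range A"
    proof clarify
      fix y
      have "y - X y = A ((1/c) *\<^sub>R y)"
        by (simp add: X_def scaleR_scaleC clinear_onD[OF lin])
      then show "y - X y \<in> range A" by simp
    qed
    have "B x = S (sqrt c *\<^sub>R x)"
      by (simp add: B_def scaleR_scaleC clinear_onD[OF S(2)])
    then show ?thesis
      using subsetD[OF closure_mono[OF sub] root_series_closure[OF linX contrX]] by (simp add: S_def)
  qed
  moreover have "C (B x) = B (C x)" if C: "bounded_linear C" "\<And>x. C (A x) = A (C x)" for C x
  proof -
    have "C (X y) = X (C y)" for y
      using C by (simp add: X_def linear_diff linear_cmul bounded_linear.linear)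
    then show ?thesis
      using root_series_commute[OF linX contrX C(1)] C(1)
      by (simp add: B_def S_def linear_cmul bounded_linear.linear)
  qed
  ultimately show ?thesis
    using that by blast
qed

text \<open>For y = B x - C x commutation gives (B + C) y = 0. Both forms are nonnegative, so B y
  and C y vanish separately, and selfadjointness turns this into y being orthogonal to
  itself.\<close>

lemma pos_op_sqrt_unique:
  assumes B: "pos_op B" and C: "pos_op C" and comm: "\<And>x. C (B x) = B (C x)"
    and sq: "\<And>x. B (B x) = C (C x)"
  shows "B = C"
proof
  fix x
  have lin: "clinear_on UNIV B" "clinear_on UNIV C"
    and pos: "0 \<le> Re (cinner (B y) y)" "0 \<le> Re (cinner (C y) y)" for y
    using B C by (auto simp: pos_op_def complex_nonneg_Reals_iff)
  define y where "y = B x - C x"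
  have "B y + C y = 0"
    by (simp add: y_def clinear_on_diff[OF lin(1)] clinear_on_diff[OF lin(2)] sq comm)
  then have "Re (cinner (B y) y) + Re (cinner (C y) y) = 0"
    by (metis cinner_add_left cinner_zero_left plus_complex.simps(1) zero_complex.simps(1))
  then have "B y = 0" "C y = 0"
    using pos_op_zero_form[OF B] pos_op_zero_form[OF C] pos[of y] by fastforce+
  then have "cinner y y = 0"
    using pos_op_selfadj[OF B] pos_op_selfadj[OF C] y_def
    by (metis cinner_diff_left cinner_zero_right diff_zero selfadj_def)
  then show "B x = C x"
    by (simp add: cinner_self y_def)
qed

lemma op_sqrt_pos_op:
  fixes A :: "'a::chilbert_space \<Rightarrow> 'a"
  assumes A: "pos_op A"
  shows "pos_op (op_sqrt A)" "op_sqrt A (op_sqrt A x) = A x" "op_sqrt A x \<in> closure (range A)"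
proof -
  obtain B where B: "pos_op B" "\<And>x. B (B x) = A x" "\<And>x. B x \<in> closure (range A)"
    "\<And>C x. bounded_linear C \<Longrightarrow> (\<And>x. C (A x) = A (C x)) \<Longrightarrow> C (B x) = B (C x)"
    using pos_op_sqrt_exists[OF A] by blast
  have "op_sqrt A = B"
    unfolding op_sqrt_def
  proof (rule the_equality)
    show "pos_op B \<and> B \<circ> B = A"
      using B by auto
    fix C
    assume C: "pos_op C \<and> C \<circ> C = A"
    then have CC: "C (C x) = A x" for x
      by (auto simp: fun_eq_iff)
    \<comment> \<open>C commutes with its own square A, hence with the series B in A.\<close>
    have "C (B x) = B (C x)" for x
      using B(4)[of C x] C CC by (metis pos_op_def)
    then have "B = C"
      using pos_op_sqrt_unique[OF B(1)] B(2) C CC by metis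
    then show "C = B" by simp
  qed
  then show "pos_op (op_sqrt A)" "op_sqrt A (op_sqrt A x) = A x" "op_sqrt A x \<in> closure (range A)"
    using B by simp_all
qed

section \<open>The Hardy space\<close>

lemma finite_multi_indices_subset_box:
  assumes "finite F" "F \<subseteq> multi_indices n"
  obtains N where "F \<subseteq> {1..n} \<rightarrow>\<^sub>E {..<N}"
proof
  let ?N = "Suc (\<Sum>k\<in>F. \<Sum>i\<in>{1..n}. k i)"
  have "k i < ?N" if "k \<in> F" "i \<in> {1..n}" for k i
  proof -
    have "k i \<le> (\<Sum>i\<in>{1..n}. k i)"
      using that by (intro member_le_sum) auto
    also have "\<dots> \<le> (\<Sum>k\<in>F. \<Sum>i\<in>{1..n}. k i)"
      using that assms(1) by (intro member_le_sum[of k F "\<lambda>k. \<Sum>i\<in>{1..n}. k i"]) auto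
    finally show ?thesis by simp
  qed
  then show "F \<subseteq> {1..n} \<rightarrow>\<^sub>E {..<?N}"
    using assms(2) by (auto simp: multi_indices_def PiE_iff)
qed

section \<open>Power series on the polydisc and the identity theorem\<close>

definition monomial :: "nat \<Rightarrow> (nat \<Rightarrow> complex) \<Rightarrow> (nat \<Rightarrow> nat) \<Rightarrow> complex"
  where "monomial n z k = (\<Prod>i=1..n. z i ^ k i)"

lemma polydisc_norm_less: "z \<in> polydisc n \<Longrightarrow> i \<in> {1..n} \<Longrightarrow> norm (z i) < 1"
  by (auto simp: polydisc_def PiE_iff)

lemma polydisc_upd: "z \<in> polydisc n \<Longrightarrow> i \<in> {1..n} \<Longrightarrow> norm t < 1 \<Longrightarrow> z(i := t) \<in> polydisc n"
  by (auto simp: polydisc_def PiE_iff extensional_def)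

text \<open>Over a box the sum factors into truncated geometric series, and every finite set of
  indices lies in a box.\<close>

lemma summable_monomial:
  assumes z: "z \<in> polydisc n"
  shows "(\<lambda>k. norm (monomial n z k)) summable_on multi_indices n"
proof (rule nonneg_bdd_above_summable_on)
  show "bdd_above (sum (\<lambda>k. norm (monomial n z k)) ` {F. F \<subseteq> multi_indices n \<and> finite F})"
  proof (rule bdd_aboveI2)
    fix F
    assume "F \<in> {F. F \<subseteq> multi_indices n \<and> finite F}"
    then obtain N where N: "F \<subseteq> {1..n} \<rightarrow>\<^sub>E {..<N}"
      using finite_multi_indices_subset_box by blast
    have "(\<Sum>k\<in>F. norm (monomial n z k)) \<le> (\<Sum>k\<in>{1..n} \<rightarrow>\<^sub>E {..<N}. norm (monomial n z k))"
      using N by (intro sum_mono2) (auto intro: finite_PiE)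
    also have "\<dots> = (\<Prod>i=1..n. \<Sum>j<N. norm (z i) ^ j)"
      by (subst prod_sum_PiE) (auto simp: monomial_def norm_power simp flip: prod_norm)
    also have "\<dots> \<le> (\<Prod>i=1..n. \<Sum>j. norm (z i) ^ j)"
      using polydisc_norm_less[OF z]
      by (intro prod_mono conjI sum_nonneg sum_le_suminf summable_geometric) auto
    finally show "(\<Sum>k\<in>F. norm (monomial n z k)) \<le> (\<Prod>i=1..n. \<Sum>j. norm (z i) ^ j)" .
  qed
qed simp

lemma powser_zero_imp_coeff_zero:
  fixes g :: "nat \<Rightarrow> complex"
  assumes "\<And>t. norm t < 1 \<Longrightarrow> (\<lambda>m. g m * t ^ m) sums 0"
  shows "g m = 0"
proof (induction m rule: less_induct)
  case (less m)
  have "(\<lambda>j. g (j + m) * t ^ j) sums 0" if "t \<noteq> 0" "norm t < 1" for t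
  proof -
    have "(\<lambda>j. g (j + m) * t ^ (j + m)) sums (0 - (\<Sum>j<m. g j * t ^ j))"
      by (rule sums_split_initial_segment[OF assms[OF that(2)]])
    then have "(\<lambda>j. g (j + m) * t ^ (j + m) / t ^ m) sums (0 / t ^ m)"
      using less by (intro sums_divide) simp
    then show ?thesis
      using that by (simp add: power_add)
  qed
  \<comment> \<open>Dividing by the power of t was only possible off the origin; the coefficient is
    the limit there.\<close>
  then have "((\<lambda>_. 0) \<longlongrightarrow> g (0 + m)) (at (0::complex))"
    by (intro powser_limit_0_strong[of 1 "\<lambda>j. g (j + m)"]) auto
  then have "g (0 + m) = 0"
    using tendsto_unique[OF _ _ tendsto_const] at_neq_bot by blast
  then show ?case by simp
qed

lemma multi_index_eqI:
  assumes "k \<in> multi_indices n" "l \<in> multi_indices n" "\<And>i. i \<in> {1..n} \<Longrightarrow> k i = l i"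
  shows "k = l"
  using assms by (auto simp: multi_indices_def intro: PiE_ext)

lemma monomial_split:
  assumes "p \<in> {1..n}"
  shows "monomial n z k = z p ^ k p * (\<Prod>i\<in>{1..n} - {p}. z i ^ k i)"
  unfolding monomial_def using assms by (subst prod.remove[of _ p]) auto

text \<open>The variables are treated one at a time. \<open>L j\<close> keeps the indices that agree
  with \<kappa> in the first j coordinates; the series restricted to it still vanishes on the whole
  polydisc, and \<open>L n\<close> contains only \<kappa>.\<close>

lemma multi_power_series_zero_imp_coeff_zero:
  fixes c :: "(nat \<Rightarrow> nat) \<Rightarrow> complex"
  assumes bounded: "\<And>k. k \<in> multi_indices n \<Longrightarrow> norm (c k) \<le> C"
    and zero: "\<And>z. z \<in> polydisc n \<Longrightarrow> ((\<lambda>k. monomial n z k * c k) has_sum 0) (multi_indices n)"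
    and \<kappa>: "\<kappa> \<in> multi_indices n"
  shows "c \<kappa> = 0"
proof -
  define L where "L j = {k \<in> multi_indices n. \<forall>i\<in>{1..j}. k i = \<kappa> i}" for j
  have summable: "(\<lambda>k. monomial n z k * c k) summable_on B"
    if "z \<in> polydisc n" "B \<subseteq> multi_indices n" for z B
  proof (rule summable_on_subset_banach[OF abs_summable_summable that(2)])
    show "(\<lambda>k. norm (monomial n z k * c k)) summable_on multi_indices n"
      by (rule summable_on_comparison_test[OF summable_on_cmult_left[OF summable_monomial[OF that(1)], of C]])
        (simp_all add: norm_mult mult_left_mono bounded)
  qed
  have main: "((\<lambda>k. monomial n z k * c k) has_sum 0) (L j)" if "j \<le> n" "z \<in> polydisc n" for j z
    using that
  proof (induction j arbitrary: z)
    case 0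
    then show ?case
      using zero by (simp add: L_def)
  next
    case (Suc j)
    let ?p = "Suc j"
    have p: "?p \<in> {1..n}"
      using Suc.prems by simp
    define B where "B m = {k \<in> L j. k ?p = m}" for m
    have B: "B m \<subseteq> multi_indices n" for m
      by (auto simp: B_def L_def)
    \<comment> \<open>The coefficient of t^m when variable \<open>?p\<close> is replaced by t. It is
      read off at 1/2, a nonzero point of the disc, and the factor 2^m undoes that choice.\<close>
    define g where "g m = 2 ^ m * (\<Sum>\<^sub>\<infinity>k\<in>B m. monomial n (z(?p := 1/2)) k * c k)" for m
    have half: "z(?p := 1/2) \<in> polydisc n"
      using Suc.prems p by (intro polydisc_upd) auto
    have fiber: "((\<lambda>k. monomial n (z(?p := t)) k * c k) has_sum (g m * t ^ m)) (B m)" for t m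
    proof -
      have "((\<lambda>k. (2 ^ m * t ^ m) * (monomial n (z(?p := 1/2)) k * c k)) has_sum
          (2 ^ m * t ^ m) * (\<Sum>\<^sub>\<infinity>k\<in>B m. monomial n (z(?p := 1/2)) k * c k)) (B m)"
        by (intro has_sum_cmult_right has_sum_infsum summable half B)
      moreover have "(2 ^ m * t ^ m) * (monomial n (z(?p := 1/2)) k * c k) = monomial n (z(?p := t)) k * c k"
        if "k \<in> B m" for k
      proof -
        have "(\<Prod>i\<in>{1..n} - {?p}. (z(?p := s)) i ^ k i) = (\<Prod>i\<in>{1..n} - {?p}. z i ^ k i)" for s
          by (intro prod.cong) auto
        then show ?thesis
          using that unfolding monomial_split[OF p] by (simp add: B_def power_divide)
      qed
      ultimately have "((\<lambda>k. monomial n (z(?p := t)) k * c k) has_sum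
          (2 ^ m * t ^ m) * (\<Sum>\<^sub>\<infinity>k\<in>B m. monomial n (z(?p := 1/2)) k * c k)) (B m)"
        by (simp cong: has_sum_cong)
      then show ?thesis
        by (simp add: g_def mult_ac)
    qed
    have "g m = 0" for m
    proof (rule powser_zero_imp_coeff_zero)
      fix t :: complex
      assume t: "norm t < 1"
      let ?f = "\<lambda>k. monomial n (z(?p := t)) k * c k"
      have "(?f has_sum 0) (L j)"
        using Suc.prems by (intro Suc.IH polydisc_upd p t) auto
      then have "((\<lambda>x. ?f (snd x)) has_sum 0) (Sigma UNIV B)"
        by (subst has_sum_reindex_bij_witness[where T = "L j" and h = ?f and j = snd and i = "\<lambda>k. (k ?p, k)"])
          (auto simp: B_def)
      then have "((\<lambda>m. g m * t ^ m) has_sum 0) UNIV"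
        by (rule has_sum_SigmaD) (use fiber in simp)
      then show "(\<lambda>m. g m * t ^ m) sums 0"
        by (rule has_sum_imp_sums)
    qed
    moreover have "L (Suc j) = B (\<kappa> ?p)"
      by (auto simp: L_def B_def atLeastAtMostSuc_conv)
    ultimately show ?case
      using fiber[where t = "z ?p" and m = "\<kappa> ?p"] by simp
  qed
  \<comment> \<open>Nonzero coordinates keep the one remaining monomial from vanishing.\<close>
  define z where "z = (\<lambda>i\<in>{1..n}. 1/2 :: complex)"
  have "z \<in> polydisc n"
    by (auto simp: z_def polydisc_def)
  moreover have "L n = {\<kappa>}"
    using \<kappa> multi_index_eqI[of _ n \<kappa>] by (auto simp: L_def)
  ultimately have "((\<lambda>k. monomial n z k * c k) has_sum 0) {\<kappa>}"
    using main[of n z] by simp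
  then have "monomial n z \<kappa> * c \<kappa> = 0"
    by (simp add: has_sum_finite_iff)
  moreover have "monomial n z \<kappa> \<noteq> 0"
    by (simp add: monomial_def z_def)
  ultimately show ?thesis by simp
qed

section \<open>Square summable families and the Hilbert space they form\<close>

lemma square_summable_subset: "E \<subseteq> F \<Longrightarrow> square_summable n E \<subseteq> square_summable n F"
  by (auto simp: square_summable_def)

lemma square_summable_zero: "a \<in> square_summable n E \<Longrightarrow> k \<notin> multi_indices n \<Longrightarrow> a k = 0"
  by (simp add: square_summable_def)

lemma square_summable_mem: "a \<in> square_summable n E \<Longrightarrow> k \<in> multi_indices n \<Longrightarrow> a k \<in> E"
  by (simp add: square_summable_def)

lemma square_summable_norm:
  "a \<in> square_summable n E \<Longrightarrow> (\<lambda>k. (norm (a k))\<^sup>2) summable_on multi_indices n"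
  by (simp add: square_summable_def)

text \<open>Boundedness is all that convergence inside the polydisc asks for, the monomials being
  absolutely summable there.\<close>

lemma square_summable_bounded:
  assumes "a \<in> square_summable n E"
  shows "\<exists>C. \<forall>k\<in>multi_indices n. norm (a k) \<le> C"
proof -
  let ?S = "\<Sum>\<^sub>\<infinity>k\<in>multi_indices n. (norm (a k))\<^sup>2"
  have "norm (a k) \<le> sqrt ?S" if "k \<in> multi_indices n" for k
  proof (rule real_le_rsqrt)
    have "(\<Sum>k\<in>{k}. (norm (a k))\<^sup>2) \<le> ?S"
      using that square_summable_norm[OF assms] by (intro finite_sum_le_infsum) auto
    then show "(norm (a k))\<^sup>2 \<le> ?S" by simp
  qed
  then show ?thesis
    by blast
qed

lemma power_series_has_sum:
  fixes a :: "(nat \<Rightarrow> nat) \<Rightarrow> 'a::chilbert_space"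
  assumes a: "a \<in> square_summable n E" and z: "z \<in> polydisc n"
  shows "((\<lambda>k. monomial n z k *\<^sub>C a k) has_sum power_series n a z) (multi_indices n)"
proof -
  obtain C where C: "\<And>k. k \<in> multi_indices n \<Longrightarrow> norm (a k) \<le> C"
    using square_summable_bounded[OF a] by blast
  have "(\<lambda>k. norm (monomial n z k *\<^sub>C a k)) summable_on multi_indices n"
    by (rule summable_on_comparison_test[OF summable_on_cmult_left[OF summable_monomial[OF z], of C]])
      (simp_all add: mult_left_mono C)
  then show ?thesis
    using z by (simp add: power_series_def monomial_def abs_summable_summable)
qed

lemma power_series_outside: "z \<notin> polydisc n \<Longrightarrow> power_series n a z = 0"
  by (simp add: power_series_def)

lemma power_series_eqI:
  fixes a :: "(nat \<Rightarrow> nat) \<Rightarrow> 'a::chilbert_space"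
  assumes "\<And>z. z \<in> polydisc n \<Longrightarrow>
      ((\<lambda>k. monomial n z k *\<^sub>C a k) has_sum f z) (multi_indices n)"
    and "\<And>z. z \<notin> polydisc n \<Longrightarrow> f z = 0"
  shows "power_series n a = f"
  using assms by (auto simp: fun_eq_iff power_series_def monomial_def intro: infsumI)

definition csubspace_on :: "'a::complex_vector set \<Rightarrow> bool"
  where "csubspace_on E \<longleftrightarrow> 0 \<in> E \<and> (\<forall>x\<in>E. \<forall>y\<in>E. x + y \<in> E) \<and> (\<forall>c. \<forall>x\<in>E. c *\<^sub>C x \<in> E)"

lemma csubspace_on_UNIV: "csubspace_on UNIV"
  by (simp add: csubspace_on_def)

lemma square_summable_add:
  assumes E: "csubspace_on E" and a: "a \<in> square_summable n E" and b: "b \<in> square_summable n E"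
  shows "a + b \<in> square_summable n E"
proof -
  have "(norm (a k + b k))\<^sup>2 \<le> 2 * (norm (a k))\<^sup>2 + 2 * (norm (b k))\<^sup>2" for k
  proof -
    have "(norm (a k + b k))\<^sup>2 \<le> (norm (a k) + norm (b k))\<^sup>2"
      by (intro power_mono norm_triangle_ineq) simp
    also have "\<dots> \<le> 2 * (norm (a k))\<^sup>2 + 2 * (norm (b k))\<^sup>2"
      using sum_squares_bound[of "norm (a k)" "norm (b k)"] by (simp add: power2_sum)
    finally show ?thesis .
  qed
  moreover have "(\<lambda>k. 2 * (norm (a k))\<^sup>2 + 2 * (norm (b k))\<^sup>2) summable_on multi_indices n"
    by (intro summable_on_add summable_on_cmult_right square_summable_norm[OF a] square_summable_norm[OF b])
  ultimately have "(\<lambda>k. (norm (a k + b k))\<^sup>2) summable_on multi_indices n"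
    using summable_on_comparison_test by (metis (no_types, lifting) zero_le_power2)
  with assms show ?thesis
    by (auto simp: square_summable_def csubspace_on_def)
qed

lemma square_summable_scale:
  assumes E: "csubspace_on E" and a: "a \<in> square_summable n E"
  shows "c *\<^sub>C a \<in> square_summable n E"
  using assms by (auto simp: square_summable_def csubspace_on_def scaleC_fun_def power_mult_distrib
      intro: summable_on_cmult_right)

lemma square_summable_diff:
  fixes a :: "(nat \<Rightarrow> nat) \<Rightarrow> 'a::complex_inner"
  assumes E: "csubspace_on E" and a: "a \<in> square_summable n E" and b: "b \<in> square_summable n E"
  shows "a - b \<in> square_summable n E"
proof -
  have "a - b = a + (-1) *\<^sub>C b"
    by (auto simp: fun_eq_iff scaleC_fun_def scaleC_minus1_left)
  then show ?thesis
    using square_summable_add[OF E a square_summable_scale[OF E b]] by (simp only:)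
qed

lemma power_series_add:
  fixes a :: "(nat \<Rightarrow> nat) \<Rightarrow> 'a::chilbert_space"
  assumes "a \<in> square_summable n E" "b \<in> square_summable n F"
  shows "power_series n (a + b) = power_series n a + power_series n b"
  using has_sum_add[OF power_series_has_sum[OF assms(1)] power_series_has_sum[OF assms(2)]]
  by (intro power_series_eqI) (simp_all add: scaleC_add_right power_series_outside)

lemma power_series_scale:
  fixes a :: "(nat \<Rightarrow> nat) \<Rightarrow> 'a::chilbert_space"
  assumes "a \<in> square_summable n E"
  shows "power_series n (c *\<^sub>C a) = c *\<^sub>C power_series n a"
  using has_sum_bounded_linear[OF bounded_linear_scaleC power_series_has_sum[OF assms], of _ c]
  by (intro power_series_eqI)
    (simp_all add: scaleC_fun_def scaleC_scaleC mult.commute[of c] power_series_outside)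

lemma power_series_diff:
  fixes a :: "(nat \<Rightarrow> nat) \<Rightarrow> 'a::chilbert_space"
  assumes "a \<in> square_summable n E" "b \<in> square_summable n F"
  shows "power_series n (a - b) = power_series n a - power_series n b"
proof (intro power_series_eqI)
  fix z
  assume z: "z \<in> polydisc n"
  show "((\<lambda>k. monomial n z k *\<^sub>C (a - b) k) has_sum (power_series n a - power_series n b) z) (multi_indices n)"
    using has_sum_add[OF power_series_has_sum[OF assms(1) z]
        has_sum_bounded_linear[OF bounded_linear_minus[OF bounded_linear_ident] power_series_has_sum[OF assms(2) z]]]
    by (simp add: scaleC_diff_right)
qed (simp add: power_series_outside)

text \<open>Pairing with a fixed vector reduces to scalar series; taking that vector to be the
  coefficient difference itself finishes.\<close>

lemma power_series_inject:
  fixes a :: "(nat \<Rightarrow> nat) \<Rightarrow> 'a::chilbert_space"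
  assumes a: "a \<in> square_summable n UNIV" and b: "b \<in> square_summable n UNIV"
    and eq: "power_series n a = power_series n b"
  shows "a = b"
proof
  fix \<kappa>
  show "a \<kappa> = b \<kappa>"
  proof (cases "\<kappa> \<in> multi_indices n")
    case True
    have d: "a - b \<in> square_summable n UNIV"
      by (rule square_summable_diff[OF csubspace_on_UNIV a b])
    obtain C where C: "\<And>k. k \<in> multi_indices n \<Longrightarrow> norm ((a - b) k) \<le> C"
      using square_summable_bounded[OF d] by blast
    have "cinner ((a - b) \<kappa>) v = 0" for v
    proof (rule multi_power_series_zero_imp_coeff_zero[OF _ _ True])
      show "norm (cinner ((a - b) k) v) \<le> C * norm v" if "k \<in> multi_indices n" for k
        using cinner_Cauchy_Schwarz[of "(a - b) k" v] mult_right_mono[OF C[OF that] norm_ge_zero, of v]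
        by linarith
      show "((\<lambda>k. monomial n z k * cinner ((a - b) k) v) has_sum 0) (multi_indices n)"
        if "z \<in> polydisc n" for z
        using has_sum_bounded_linear[OF bounded_linear_cinner_left power_series_has_sum[OF d that], of v]
        by (simp add: cinner_scaleC_left power_series_diff[OF a b] eq)
    qed
    from this[of "(a - b) \<kappa>"] show ?thesis
      by (simp add: cinner_self)
  qed (use square_summable_zero a b in metis)
qed

lemma hardy_coeff_power_series:
  fixes a :: "(nat \<Rightarrow> nat) \<Rightarrow> 'a::chilbert_space"
  assumes "a \<in> square_summable n E"
  shows "hardy_coeff n (power_series n a) = a"
proof -
  have "a \<in> square_summable n UNIV"
    using assms square_summable_subset[of E UNIV] by auto
  then show ?thesis
    unfolding hardy_coeff_def by (intro the_equality) (auto intro: power_series_inject)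
qed

lemma hardy_inner_power_series:
  fixes a :: "(nat \<Rightarrow> nat) \<Rightarrow> 'a::chilbert_space"
  assumes "a \<in> square_summable n E" "b \<in> square_summable n F"
  shows "((\<lambda>k. cinner (a k) (b k)) has_sum hardy_inner n (power_series n a) (power_series n b))
    (multi_indices n)"
proof -
  have "cmod (cinner (a k) (b k)) \<le> (norm (a k))\<^sup>2 + (norm (b k))\<^sup>2" for k
    using cinner_Cauchy_Schwarz[of "a k" "b k"] sum_squares_bound[of "norm (a k)" "norm (b k)"]
      mult_nonneg_nonneg[OF norm_ge_zero[of "a k"] norm_ge_zero[of "b k"]]
    unfolding mult.assoc by linarith
  then have "(\<lambda>k. norm (cinner (a k) (b k))) summable_on multi_indices n"
    by (intro summable_on_comparison_test[OF summable_on_add[OF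
        square_summable_norm[OF assms(1)] square_summable_norm[OF assms(2)]]]) auto
  then show ?thesis
    unfolding hardy_inner_def hardy_coeff_power_series[OF assms(1)] hardy_coeff_power_series[OF assms(2)]
    by (rule has_sum_infsum[OF abs_summable_summable])
qed

lemma hardy_inner_self:
  fixes a :: "(nat \<Rightarrow> nat) \<Rightarrow> 'a::chilbert_space"
  assumes "a \<in> square_summable n E"
  shows "hardy_inner n (power_series n a) (power_series n a)
    = of_real (\<Sum>\<^sub>\<infinity>k\<in>multi_indices n. (norm (a k))\<^sup>2)"
proof -
  have "((\<lambda>k. complex_of_real ((norm (a k))\<^sup>2)) has_sum
      of_real (\<Sum>\<^sub>\<infinity>k\<in>multi_indices n. (norm (a k))\<^sup>2)) (multi_indices n)"
    by (rule has_sum_of_real[OF has_sum_infsum[OF square_summable_norm[OF assms]]])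
  then show ?thesis
    by (rule has_sum_unique[OF hardy_inner_power_series[OF assms assms, unfolded cinner_self]])
qed

lemma hardy_norm_power_series:
  fixes a :: "(nat \<Rightarrow> nat) \<Rightarrow> 'a::chilbert_space"
  assumes "a \<in> square_summable n E"
  shows "ip_norm (hardy_inner n) (power_series n a) = sqrt (\<Sum>\<^sub>\<infinity>k\<in>multi_indices n. (norm (a k))\<^sup>2)"
  by (simp add: ip_norm_def hardy_inner_self[OF assms])

lemma hardyE:
  assumes "f \<in> hardy n E"
  obtains a where "a \<in> square_summable n E" "f = power_series n a"
  using assms by (auto simp: hardy_def)

lemma hardyI: "a \<in> square_summable n E \<Longrightarrow> power_series n a \<in> hardy n E"
  by (simp add: hardy_def)

text \<open>The classical l2 argument: coefficients converge pointwise inside the closed set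
  \<open>E\<close>, and the Cauchy estimates over finite index sets survive this limit. A uniform
  bound over finite sets then controls the whole sum.\<close>

lemma hardy_complete:
  fixes E :: "'a::chilbert_space set"
  assumes E: "csubspace_on E" and cl: "closed E" and X: "\<And>j. X j \<in> hardy n E"
    and Cauchy: "\<And>e. e > 0 \<Longrightarrow> \<exists>N. \<forall>i\<ge>N. \<forall>j\<ge>N. ip_norm (hardy_inner n) (X i - X j) < e"
  shows "\<exists>L\<in>hardy n E. (\<lambda>j. ip_norm (hardy_inner n) (X j - L)) \<longlonglongrightarrow> 0"
proof -
  have "\<forall>j. \<exists>a. a \<in> square_summable n E \<and> X j = power_series n a"
    using X hardyE by metis
  then obtain a where a: "\<And>j. a j \<in> square_summable n E" and Xa: "\<And>j. X j = power_series n (a j)"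
    by metis
  have ad: "a i - a j \<in> square_summable n E" for i j
    by (rule square_summable_diff[OF E a a])
  have partial: "(\<Sum>k\<in>F. (norm (a i k - a j k))\<^sup>2) \<le> e\<^sup>2"
    if "ip_norm (hardy_inner n) (X i - X j) < e" "finite F" "F \<subseteq> multi_indices n" for i j e F
  proof -
    have "(\<Sum>k\<in>F. (norm ((a i - a j) k))\<^sup>2) \<le> (\<Sum>\<^sub>\<infinity>k\<in>multi_indices n. (norm ((a i - a j) k))\<^sup>2)"
      by (rule finite_sum_le_infsum[OF square_summable_norm[OF ad] that(2,3)]) simp
    also have "\<dots> \<le> e\<^sup>2"
      using that(1) unfolding Xa power_series_diff[OF a a, symmetric] hardy_norm_power_series[OF ad]
      by (rule sqrt_le_D[OF less_imp_le])
    finally show ?thesis by simp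
  qed
  have "\<exists>l. (\<lambda>j. a j k) \<longlonglongrightarrow> l" if k: "k \<in> multi_indices n" for k
  proof -
    have "Cauchy (\<lambda>j. a j k)"
    proof (rule metric_CauchyI)
      fix e :: real
      assume e: "e > 0"
      then obtain N where N: "\<forall>i\<ge>N. \<forall>j\<ge>N. ip_norm (hardy_inner n) (X i - X j) < e / 2"
        using Cauchy[of "e / 2"] by auto
      have "dist (a i k) (a j k) < e" if "i \<ge> N" "j \<ge> N" for i j
      proof -
        have "(norm (a i k - a j k))\<^sup>2 \<le> (e / 2)\<^sup>2"
          using partial[of i j "e / 2" "{k}"] N that k by simp
        then have "norm (a i k - a j k) \<le> e / 2"
          by (rule power2_le_imp_le) (use e in simp)
        with e show ?thesis
          by (simp add: dist_norm)
      qed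
      then show "\<exists>N. \<forall>i\<ge>N. \<forall>j\<ge>N. dist (a i k) (a j k) < e"
        by blast
    qed
    then show ?thesis
      unfolding Cauchy_convergent_iff convergent_def .
  qed
  then obtain l' where l': "\<And>k. k \<in> multi_indices n \<Longrightarrow> (\<lambda>j. a j k) \<longlonglongrightarrow> l' k"
    by metis
  \<comment> \<open>Values off the multi-indices are set to 0, as membership in
    \<open>square_summable\<close> demands.\<close>
  define l where "l k = (if k \<in> multi_indices n then l' k else 0)" for k
  have l: "(\<lambda>j. a j k) \<longlonglongrightarrow> l k" if "k \<in> multi_indices n" for k
    using l'[OF that] that by (simp add: l_def)
  have lE: "l k \<in> E" if "k \<in> multi_indices n" for k
    using closed_sequentially[OF cl _ l[OF that]] square_summable_mem[OF a that] by blast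
  have tail: "(\<Sum>k\<in>F. (norm ((a i - l) k))\<^sup>2) \<le> e\<^sup>2"
    if N: "\<forall>i\<ge>N. \<forall>j\<ge>N. ip_norm (hardy_inner n) (X i - X j) < e" and "i \<ge> N"
      and F: "finite F" "F \<subseteq> multi_indices n" for i N e F
  proof (rule Lim_bounded)
    show "(\<lambda>j. \<Sum>k\<in>F. (norm (a i k - a j k))\<^sup>2) \<longlonglongrightarrow> (\<Sum>k\<in>F. (norm ((a i - l) k))\<^sup>2)"
      unfolding fun_diff_def using F l by (intro tendsto_intros) auto
    show "\<forall>j\<ge>N. (\<Sum>k\<in>F. (norm (a i k - a j k))\<^sup>2) \<le> e\<^sup>2"
      using N \<open>i \<ge> N\<close> F by (auto intro: partial)
  qed
  have dl: "a i - l \<in> square_summable n E"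
    if N: "\<forall>i\<ge>N. \<forall>j\<ge>N. ip_norm (hardy_inner n) (X i - X j) < e" and "i \<ge> N" for i N e
  proof -
    have "(\<lambda>k. (norm ((a i - l) k))\<^sup>2) summable_on multi_indices n"
      by (rule nonneg_bdd_above_summable_on) (use tail[OF that] in \<open>auto intro!: bdd_aboveI2[where M = "e\<^sup>2"]\<close>)
    moreover have "a i k - l k \<in> E" if "k \<in> multi_indices n" for k
    proof -
      have "a i k + (-1) *\<^sub>C l k \<in> E"
        using E square_summable_mem[OF a that] lE[OF that] by (simp add: csubspace_on_def)
      then show ?thesis
        by (simp add: scaleC_minus1_left)
    qed
    ultimately show ?thesis
      using square_summable_zero[OF a] by (simp add: square_summable_def l_def)
  qed
  obtain N1 where N1: "\<forall>i\<ge>N1. \<forall>j\<ge>N1. ip_norm (hardy_inner n) (X i - X j) < 1"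
    using Cauchy[of 1] by auto
  \<comment> \<open>The limit is a difference of two members, so its square summability comes from
    the vector space structure.\<close>
  have "a N1 - (a N1 - l) \<in> square_summable n E"
    by (rule square_summable_diff[OF E a dl[OF N1]]) simp
  then have lS: "l \<in> square_summable n E"
    by simp
  have "(\<lambda>j. ip_norm (hardy_inner n) (X j - power_series n l)) \<longlonglongrightarrow> 0"
  proof (rule LIMSEQ_I)
    fix e :: real
    assume e: "e > 0"
    then obtain N where N: "\<forall>i\<ge>N. \<forall>j\<ge>N. ip_norm (hardy_inner n) (X i - X j) < e / 2"
      using Cauchy[of "e / 2"] by auto
    have "norm (ip_norm (hardy_inner n) (X i - power_series n l) - 0) < e" if "i \<ge> N" for i
    proof -
      have "(\<Sum>\<^sub>\<infinity>k\<in>multi_indices n. (norm ((a i - l) k))\<^sup>2) \<le> (e / 2)\<^sup>2"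
        by (rule infsum_le_finite_sums[OF square_summable_norm[OF dl[OF N that]]]) (rule tail[OF N that])
      then have "ip_norm (hardy_inner n) (X i - power_series n l) \<le> e / 2"
        unfolding Xa power_series_diff[OF a lS, symmetric] hardy_norm_power_series[OF dl[OF N that]]
        using e by (intro real_le_lsqrt) (auto intro: infsum_nonneg)
      moreover have "0 \<le> ip_norm (hardy_inner n) (X i - power_series n l)"
        unfolding Xa power_series_diff[OF a lS, symmetric] hardy_norm_power_series[OF dl[OF N that]]
        by (auto intro: infsum_nonneg)
      ultimately show ?thesis
        using e by simp
    qed
    then show "\<exists>no. \<forall>i\<ge>no. norm (ip_norm (hardy_inner n) (X i - power_series n l) - 0) < e"
      by blast
  qed
  then show ?thesis
    using hardyI[OF lS] by blast
qed

lemma hilbert_space_on_hardy: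
  fixes E :: "'a::chilbert_space set"
  assumes E: "csubspace_on E" and cl: "closed E"
  shows "hilbert_space_on (hardy n E) (hardy_inner n)"
proof
  have "(\<lambda>k. 0) \<in> square_summable n E"
    using E by (simp add: square_summable_def csubspace_on_def)
  moreover have "power_series n (\<lambda>k. 0) = (0 :: _ \<Rightarrow> 'a)"
    by (intro power_series_eqI) auto
  ultimately show "0 \<in> hardy n E"
    using hardyI by metis
next
  fix f g h :: "(nat \<Rightarrow> complex) \<Rightarrow> 'a" and c
  assume f: "f \<in> hardy n E"
  obtain a where a: "a \<in> square_summable n E" "f = power_series n a"
    using f by (rule hardyE)
  show "c *\<^sub>C f \<in> hardy n E"
    using hardyI[OF square_summable_scale[OF E a(1)]] power_series_scale[OF a(1)] a(2) by metis
  show "hardy_inner n f f \<in> \<real>\<^sub>\<ge>\<^sub>0"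
    unfolding a(2) hardy_inner_self[OF a(1)] by (simp add: infsum_nonneg complex_nonneg_Reals_iff)
  show "f = 0" if "hardy_inner n f f = 0"
  proof -
    have z: "(\<Sum>\<^sub>\<infinity>k\<in>multi_indices n. (norm (a k))\<^sup>2) = 0"
      using that unfolding a(2) hardy_inner_self[OF a(1)] by simp
    have "a k = 0" for k
    proof (cases "k \<in> multi_indices n")
      case True
      then have "(norm (a k))\<^sup>2 = 0"
        using nonneg_infsum_le_0D[OF _ square_summable_norm[OF a(1)]] z by force
      then show ?thesis by simp
    qed (use square_summable_zero[OF a(1)] in simp)
    then have "f z = 0" for z
      unfolding a(2) power_series_def by simp
    then show ?thesis
      by (simp add: fun_eq_iff)
  qed
  assume g: "g \<in> hardy n E"
  obtain b where b: "b \<in> square_summable n E" "g = power_series n b"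
    using g by (rule hardyE)
  show "f + g \<in> hardy n E"
    using hardyI[OF square_summable_add[OF E a(1) b(1)]] power_series_add[OF a(1) b(1)] a(2) b(2) by metis
  show "hardy_inner n f g = cnj (hardy_inner n g f)"
  proof -
    have "((\<lambda>k. cnj (cinner (b k) (a k))) has_sum cnj (hardy_inner n g f)) (multi_indices n)"
      unfolding has_sum_cnj_iff a(2) b(2) by (rule hardy_inner_power_series[OF b(1) a(1)])
    then show ?thesis
      unfolding a(2) b(2) cinner_commute[symmetric]
      by (rule has_sum_unique[OF hardy_inner_power_series[OF a(1) b(1)]])
  qed
  show "hardy_inner n (c *\<^sub>C f) g = c * hardy_inner n f g"
  proof -
    have "((\<lambda>k. c * cinner (a k) (b k)) has_sum c * hardy_inner n f g) (multi_indices n)"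
      unfolding a(2) b(2) by (rule has_sum_cmult_right[OF hardy_inner_power_series[OF a(1) b(1)]])
    moreover have "((\<lambda>k. c * cinner (a k) (b k)) has_sum hardy_inner n (c *\<^sub>C f) g) (multi_indices n)"
      using hardy_inner_power_series[OF square_summable_scale[OF E a(1)] b(1), of c]
      unfolding a(2) b(2) power_series_scale[OF a(1)] by (simp add: scaleC_fun_def cinner_scaleC_left)
    ultimately show ?thesis
      by (rule has_sum_unique[symmetric])
  qed
  assume h: "h \<in> hardy n E"
  obtain d where d: "d \<in> square_summable n E" "h = power_series n d"
    using h by (rule hardyE)
  show "hardy_inner n (f + g) h = hardy_inner n f h + hardy_inner n g h"
  proof -
    have "((\<lambda>k. cinner (a k) (d k) + cinner (b k) (d k)) has_sum hardy_inner n f h + hardy_inner n g h) (multi_indices n)"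
      unfolding a(2) b(2) d(2)
      by (rule has_sum_add[OF hardy_inner_power_series[OF a(1) d(1)] hardy_inner_power_series[OF b(1) d(1)]])
    moreover have "((\<lambda>k. cinner (a k) (d k) + cinner (b k) (d k)) has_sum hardy_inner n (f + g) h) (multi_indices n)"
      using hardy_inner_power_series[OF square_summable_add[OF E a(1) b(1)] d(1)]
      unfolding a(2) b(2) d(2) power_series_add[OF a(1) b(1)] by (simp add: cinner_add_left)
    ultimately show ?thesis
      by (rule has_sum_unique[symmetric])
  qed
next
  fix X :: "nat \<Rightarrow> (nat \<Rightarrow> complex) \<Rightarrow> 'a"
  assume "\<And>j. X j \<in> hardy n E"
    and "\<And>e. e > 0 \<Longrightarrow> \<exists>N. \<forall>i\<ge>N. \<forall>j\<ge>N. ip_norm (hardy_inner n) (X i - X j) < e"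
  then show "\<exists>L\<in>hardy n E. (\<lambda>j. ip_norm (hardy_inner n) (X j - L)) \<longlonglongrightarrow> 0"
    by (rule hardy_complete[OF E cl])
qed

section \<open>The weighted shifts and their adjoints\<close>

lemma multi_index_upd:
  "m \<in> {1..n} \<Longrightarrow> k(m := j) \<in> multi_indices n \<longleftrightarrow> k \<in> multi_indices n"
  by (auto simp: multi_indices_def PiE_iff extensional_def)

text \<open>Raising the exponent of variable m is a bijection onto the indices with k m nonzero.
  Norms, values and inner products of the shifts are all transferred through it.\<close>

lemma has_sum_shift:
  assumes m: "m \<in> {1..n}" and zero: "\<And>k. k \<in> multi_indices n \<Longrightarrow> k m = 0 \<Longrightarrow> g k = 0"
  shows "(g has_sum s) (multi_indices n) \<longleftrightarrow>
    ((\<lambda>k. g (k(m := Suc (k m)))) has_sum s) (multi_indices n)"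
proof -
  have "(g has_sum s) (multi_indices n) \<longleftrightarrow> (g has_sum s) {k \<in> multi_indices n. k m \<noteq> 0}"
    using zero by (intro has_sum_cong_neutral) auto
  also have "\<dots> \<longleftrightarrow> ((\<lambda>k. g (k(m := Suc (k m)))) has_sum s) (multi_indices n)"
    by (rule has_sum_reindex_bij_witness[where j = "\<lambda>k. k(m := k m - 1)" and i = "\<lambda>k. k(m := Suc (k m))"])
      (use m in \<open>auto simp: multi_index_upd\<close>)
  finally show ?thesis .
qed

lemma monomial_shift:
  assumes "m \<in> {1..n}"
  shows "monomial n z (k(m := Suc (k m))) = z m * monomial n z k"
proof -
  have "(\<Prod>i\<in>{1..n} - {m}. z i ^ (k(m := Suc (k m))) i) = (\<Prod>i\<in>{1..n} - {m}. z i ^ k i)"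
    by (intro prod.cong) auto
  then show ?thesis
    unfolding monomial_split[OF assms] by simp
qed

text \<open>The action of \<^term>\<open>mult_z m \<circ> rotation n r m\<close> and of its adjoint on coefficients.\<close>

definition shift_coeffs ::
  "nat \<Rightarrow> (nat \<Rightarrow> nat \<Rightarrow> complex) \<Rightarrow> nat \<Rightarrow> ((nat \<Rightarrow> nat) \<Rightarrow> 'a::complex_vector) \<Rightarrow> (nat \<Rightarrow> nat) \<Rightarrow> 'a"
  where "shift_coeffs n r m a k =
    (if k \<in> multi_indices n \<and> k m \<noteq> 0
     then monomial n (r m) (k(m := k m - 1)) *\<^sub>C a (k(m := k m - 1)) else 0)"

definition backshift_coeffs ::
  "nat \<Rightarrow> (nat \<Rightarrow> nat \<Rightarrow> complex) \<Rightarrow> nat \<Rightarrow> ((nat \<Rightarrow> nat) \<Rightarrow> 'a::complex_vector) \<Rightarrow> (nat \<Rightarrow> nat) \<Rightarrow> 'a"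
  where "backshift_coeffs n r m b k =
    (if k \<in> multi_indices n then cnj (monomial n (r m) k) *\<^sub>C b (k(m := Suc (k m))) else 0)"

lemma shift_coeffs_zero: "k m = 0 \<Longrightarrow> shift_coeffs n r m a k = 0"
  by (simp add: shift_coeffs_def)

lemma shift_coeffs_Suc:
  "m \<in> {1..n} \<Longrightarrow> k \<in> multi_indices n \<Longrightarrow>
    shift_coeffs n r m a (k(m := Suc (k m))) = monomial n (r m) k *\<^sub>C a k"
  by (simp add: shift_coeffs_def multi_index_upd)

lemma shift_coeffs_add:
  "shift_coeffs n r m (a + b) = shift_coeffs n r m a + shift_coeffs n r m b"
  by (auto simp: fun_eq_iff shift_coeffs_def scaleC_add_right)

lemma shift_coeffs_scale:
  "shift_coeffs n r m (c *\<^sub>C a) = c *\<^sub>C shift_coeffs n r m a"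
  by (auto simp: fun_eq_iff shift_coeffs_def scaleC_fun_def scaleC_scaleC mult.commute)

context
  fixes n :: nat and r :: "nat \<Rightarrow> nat \<Rightarrow> complex" and E :: "'a::chilbert_space set"
  assumes r_unimodular: "\<And>i j. i \<in> {1..n} \<Longrightarrow> j \<in> {1..n} \<Longrightarrow> norm (r i j) = 1"
    and E: "csubspace_on E" and closed_E: "closed E"
begin

lemma norm_monomial_root: "m \<in> {1..n} \<Longrightarrow> norm (monomial n (r m) k) = 1"
  unfolding monomial_def prod_norm[symmetric] norm_power using r_unimodular by simp

text \<open>The weights are unimodular, so only the reindexing is left. As an equivalence it
  delivers both square summability and equality of norms.\<close>

lemma shift_coeffs_norm_has_sum:
  fixes a :: "(nat \<Rightarrow> nat) \<Rightarrow> 'a"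
  assumes m: "m \<in> {1..n}"
  shows "((\<lambda>k. (norm (shift_coeffs n r m a k))\<^sup>2) has_sum s) (multi_indices n) \<longleftrightarrow>
    ((\<lambda>k. (norm (a k))\<^sup>2) has_sum s) (multi_indices n)"
proof -
  have "((\<lambda>k. (norm (shift_coeffs n r m a k))\<^sup>2) has_sum s) (multi_indices n) \<longleftrightarrow>
      ((\<lambda>k. (norm (shift_coeffs n r m a (k(m := Suc (k m)))))\<^sup>2) has_sum s) (multi_indices n)"
    by (rule has_sum_shift[OF m]) (simp add: shift_coeffs_zero)
  also have "\<dots> \<longleftrightarrow> ((\<lambda>k. (norm (a k))\<^sup>2) has_sum s) (multi_indices n)"
    by (rule has_sum_cong) (simp add: shift_coeffs_Suc[OF m] norm_monomial_root[OF m])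
  finally show ?thesis .
qed

lemma shift_coeffs_square_summable:
  assumes m: "m \<in> {1..n}" and a: "a \<in> square_summable n E"
  shows "shift_coeffs n r m a \<in> square_summable n E"
proof -
  have "(\<lambda>k. (norm (shift_coeffs n r m a k))\<^sup>2) summable_on multi_indices n"
    using square_summable_norm[OF a] by (simp add: summable_on_def shift_coeffs_norm_has_sum[OF m])
  moreover have "shift_coeffs n r m a k \<in> E" for k
    using E square_summable_mem[OF a, of "k(m := k m - 1)"] m
    by (auto simp: shift_coeffs_def csubspace_on_def multi_index_upd)
  moreover have "shift_coeffs n r m a k = 0" if "k \<notin> multi_indices n" for k
    using that by (simp add: shift_coeffs_def)
  ultimately show ?thesis
    by (simp add: square_summable_def)
qed

lemma shift_operator_power_series:
  assumes m: "m \<in> {1..n}" and a: "a \<in> square_summable n E"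
  shows "(mult_z m \<circ> rotation n r m) (power_series n a) = power_series n (shift_coeffs n r m a)"
proof -
  define b where "b k = monomial n (r m) k *\<^sub>C a k" for k
  have "(\<lambda>k. (norm (b k))\<^sup>2) summable_on multi_indices n"
    using square_summable_norm[OF a] by (simp add: b_def norm_monomial_root[OF m])
  then have b: "b \<in> square_summable n E"
    using a E by (auto simp: square_summable_def csubspace_on_def b_def)
  have "power_series n (shift_coeffs n r m a) = (\<lambda>z. z m *\<^sub>C power_series n b z)"
  proof (rule power_series_eqI)
    fix z
    assume z: "z \<in> polydisc n"
    have "((\<lambda>k. monomial n z (k(m := Suc (k m))) *\<^sub>C shift_coeffs n r m a (k(m := Suc (k m)))) has_sum
        z m *\<^sub>C power_series n b z) (multi_indices n)"
      using has_sum_bounded_linear[OF bounded_linear_scaleC power_series_has_sum[OF b z], of "z m"]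
      by (rule has_sum_cong[THEN iffD1, rotated])
        (simp add: shift_coeffs_Suc[OF m] monomial_shift[OF m] b_def scaleC_scaleC mult.assoc)
    then show "((\<lambda>k. monomial n z k *\<^sub>C shift_coeffs n r m a k) has_sum z m *\<^sub>C power_series n b z)
        (multi_indices n)"
      by (subst has_sum_shift[OF m]) (simp_all add: shift_coeffs_zero)
  qed (simp add: power_series_outside)
  then show ?thesis
    by (simp add: mult_z_def rotation_def hardy_coeff_power_series[OF a] b_def[abs_def] monomial_def[abs_def])
qed

lemma shift_operator_isometry:
  assumes m: "m \<in> {1..n}"
  shows "isometry_on (hardy n E) (hardy_inner n) (hardy n E) (hardy_inner n) (mult_z m \<circ> rotation n r m)"
    (is "isometry_on ?H ?ip ?H ?ip ?V")
  unfolding isometry_on_def clinear_on_def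
proof (intro conjI ballI allI)
  fix f
  assume "f \<in> ?H"
  then obtain a where a: "a \<in> square_summable n E" "f = power_series n a"
    by (rule hardyE)
  have sa: "shift_coeffs n r m a \<in> square_summable n E"
    by (rule shift_coeffs_square_summable[OF m a(1)])
  have Vf: "?V f = power_series n (shift_coeffs n r m a)"
    unfolding a(2) by (rule shift_operator_power_series[OF m a(1)])
  show "?V (c *\<^sub>C f) = c *\<^sub>C ?V f" for c
  proof -
    have "?V (c *\<^sub>C f) = power_series n (shift_coeffs n r m (c *\<^sub>C a))"
      unfolding a(2) power_series_scale[OF a(1), symmetric]
      by (rule shift_operator_power_series[OF m square_summable_scale[OF E a(1)]])
    also have "\<dots> = c *\<^sub>C ?V f"
      unfolding Vf shift_coeffs_scale by (rule power_series_scale[OF sa])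
    finally show ?thesis .
  qed
  show "ip_norm ?ip (?V f) = ip_norm ?ip f"
    using shift_coeffs_norm_has_sum[OF m, of a] square_summable_norm[OF a(1)]
    unfolding Vf unfolding a(2) hardy_norm_power_series[OF sa] hardy_norm_power_series[OF a(1)]
    by (simp add: infsumI has_sum_infsum)
  fix g
  assume "g \<in> ?H"
  then obtain b where b: "b \<in> square_summable n E" "g = power_series n b"
    by (rule hardyE)
  have sb: "shift_coeffs n r m b \<in> square_summable n E"
    by (rule shift_coeffs_square_summable[OF m b(1)])
  have Vg: "?V g = power_series n (shift_coeffs n r m b)"
    unfolding b(2) by (rule shift_operator_power_series[OF m b(1)])
  show "?V (f + g) = ?V f + ?V g"
  proof -
    have "?V (f + g) = power_series n (shift_coeffs n r m (a + b))"
      unfolding a(2) b(2) power_series_add[OF a(1) b(1), symmetric]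
      by (rule shift_operator_power_series[OF m square_summable_add[OF E a(1) b(1)]])
    also have "\<dots> = ?V f + ?V g"
      unfolding Vf Vg shift_coeffs_add by (rule power_series_add[OF sa sb])
    finally show ?thesis .
  qed
next
  show "?V ` ?H \<subseteq> ?H"
    using shift_operator_power_series[OF m] shift_coeffs_square_summable[OF m]
    by (auto simp: hardy_def simp del: o_apply)
qed

lemma backshift_coeffs_square_summable:
  assumes m: "m \<in> {1..n}" and b: "b \<in> square_summable n E"
  shows "backshift_coeffs n r m b \<in> square_summable n E"
proof -
  \<comment> \<open>The backward shift forgets the coefficients with k m = 0; zeroing them makes
    \<open>has_sum_shift\<close> applicable.\<close>
  define g where "g k = (if k m = 0 then 0 else (norm (b k))\<^sup>2)" for k
  have "g summable_on multi_indices n"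
    by (rule summable_on_comparison_test[OF square_summable_norm[OF b]]) (auto simp: g_def)
  then have "(\<lambda>k. g (k(m := Suc (k m)))) summable_on multi_indices n"
    using has_sum_shift[OF m, of g] by (auto simp: summable_on_def g_def)
  then have "(\<lambda>k. (norm (backshift_coeffs n r m b k))\<^sup>2) summable_on multi_indices n"
    by (rule summable_on_cong[THEN iffD1, rotated])
      (simp add: g_def backshift_coeffs_def norm_monomial_root[OF m])
  moreover have "backshift_coeffs n r m b k \<in> E" for k
    using E square_summable_mem[OF b, of "k(m := Suc (k m))"] m
    by (auto simp: backshift_coeffs_def csubspace_on_def multi_index_upd)
  moreover have "backshift_coeffs n r m b k = 0" if "k \<notin> multi_indices n" for k
    using that by (simp add: backshift_coeffs_def)
  ultimately show ?thesis
    by (simp add: square_summable_def)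
qed

text \<open>After reindexing, each a k meets b at the raised index, and its weight moves to the
  second slot of the inner product, where it becomes conjugated.\<close>

lemma adjoint_shift_operator:
  assumes m: "m \<in> {1..n}" and b: "b \<in> square_summable n E"
  shows "adjoint_on (hardy n E) (hardy_inner n) (mult_z m \<circ> rotation n r m) (power_series n b)
    = power_series n (backshift_coeffs n r m b)"
proof (rule adjoint_on_eqI[OF hilbert_space_on_hardy[OF E closed_E]])
  let ?Wb = "backshift_coeffs n r m b"
  have Wb: "?Wb \<in> square_summable n E"
    by (rule backshift_coeffs_square_summable[OF m b])
  then show "power_series n ?Wb \<in> hardy n E"
    by (rule hardyI)
  fix f
  assume "f \<in> hardy n E"
  then obtain a where a: "a \<in> square_summable n E" "f = power_series n a"
    by (rule hardyE)
  let ?Va = "shift_coeffs n r m a"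
  have Va: "?Va \<in> square_summable n E"
    by (rule shift_coeffs_square_summable[OF m a(1)])
  have "((\<lambda>k. cinner (?Va k) (b k)) has_sum hardy_inner n (power_series n ?Va) (power_series n b))
      (multi_indices n)"
    by (rule hardy_inner_power_series[OF Va b])
  then have "((\<lambda>k. cinner (?Va (k(m := Suc (k m)))) (b (k(m := Suc (k m))))) has_sum
      hardy_inner n (power_series n ?Va) (power_series n b)) (multi_indices n)"
    by (subst (asm) has_sum_shift[OF m]) (simp_all add: shift_coeffs_zero)
  then have "((\<lambda>k. cinner (a k) (?Wb k)) has_sum
      hardy_inner n (power_series n ?Va) (power_series n b)) (multi_indices n)"
    by (rule has_sum_cong[THEN iffD1, rotated])
      (simp add: shift_coeffs_Suc[OF m] backshift_coeffs_def cinner_scaleC_left cinner_scaleC_right)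
  then show "hardy_inner n ((mult_z m \<circ> rotation n r m) f) (power_series n b)
      = hardy_inner n f (power_series n ?Wb)"
    unfolding a(2) shift_operator_power_series[OF m a(1)]
    by (rule has_sum_unique[OF _ hardy_inner_power_series[OF a(1) Wb]])
qed

text \<open>In either order the outer rotation sees the exponent already raised by the inner shift.
  This yields one extra factor \<open>r i j\<close> on one side and \<open>r j i\<close> on the
  other, whose ratio is \<open>q i j\<close>.\<close>

lemma shift_coeffs_commute:
  assumes i: "i \<in> {1..n}" and j: "j \<in> {1..n}" and "i \<noteq> j"
    and q: "r i j = q i j * r j i"
  shows "shift_coeffs n r i (shift_coeffs n r j a) k = q i j *\<^sub>C shift_coeffs n r j (shift_coeffs n r i a) k"
proof (cases "k \<in> multi_indices n \<and> k i \<noteq> 0 \<and> k j \<noteq> 0")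
  case True
  \<comment> \<open>The source index common to both orders.\<close>
  define l where "l = k(i := k i - 1, j := k j - 1)"
  have l: "l \<in> multi_indices n"
    using True i j by (simp add: l_def multi_index_upd)
  have 1: "k(i := k i - 1) = l(j := Suc (l j))" "k(j := k j - 1) = l(i := Suc (l i))"
    using True \<open>i \<noteq> j\<close> by (auto simp: l_def fun_eq_iff)
  have l': "l(j := Suc (l j)) \<in> multi_indices n" "l(i := Suc (l i)) \<in> multi_indices n"
    using l i j by (simp_all add: multi_index_upd)
  have "shift_coeffs n r i (shift_coeffs n r j a) k
      = (r i j * monomial n (r i) l * monomial n (r j) l) *\<^sub>C a l"
    using True shift_coeffs_Suc[OF j l, of r a] unfolding shift_coeffs_def[of n r i] 1
    by (simp add: monomial_shift[OF j] scaleC_scaleC)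
  moreover have "shift_coeffs n r j (shift_coeffs n r i a) k
      = (r j i * monomial n (r j) l * monomial n (r i) l) *\<^sub>C a l"
    using True shift_coeffs_Suc[OF i l, of r a] unfolding shift_coeffs_def[of n r j] 1
    by (simp add: monomial_shift[OF i] scaleC_scaleC)
  ultimately show ?thesis
    by (simp add: scaleC_scaleC q mult_ac)
next
  case False
  then show ?thesis
    using \<open>i \<noteq> j\<close> by (auto simp: shift_coeffs_def)
qed

lemma shift_operators_q_commuting:
  assumes q_diag: "\<And>i. i \<in> {1..n} \<Longrightarrow> q i i = 1"
    and q_root: "\<And>i j. i \<in> {1..n} \<Longrightarrow> j \<in> {1..n} \<Longrightarrow> r i j = q i j * r j i"
  shows "q_commuting_contractions n q (hardy n E) (hardy_inner n) (\<lambda>m. mult_z m \<circ> rotation n r m)"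
  unfolding q_commuting_contractions_def
proof (intro conjI ballI)
  fix i
  assume i: "i \<in> {1..n}"
  show "contraction_on (hardy n E) (hardy_inner n) (mult_z i \<circ> rotation n r i)"
    using shift_operator_isometry[OF i] by (simp add: isometry_on_def contraction_on_def)
  fix j f
  assume j: "j \<in> {1..n}" and "f \<in> hardy n E"
  then obtain a where a: "a \<in> square_summable n E" "f = power_series n a"
    by (auto elim: hardyE)
  note ss = shift_coeffs_square_summable
  let ?ji = "shift_coeffs n r j (shift_coeffs n r i a)"
  have "shift_coeffs n r i (shift_coeffs n r j a) = q i j *\<^sub>C ?ji"
    using shift_coeffs_commute[OF i j, of q a] q_root[OF i j] q_diag[OF i]
    by (cases "i = j") (auto simp: fun_eq_iff scaleC_fun_def scaleC_one)
  then have "power_series n (shift_coeffs n r i (shift_coeffs n r j a)) = q i j *\<^sub>C power_series n ?ji"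
    using power_series_scale[OF ss[OF j ss[OF i a(1)]]] by metis
  then show "(mult_z i \<circ> rotation n r i) ((mult_z j \<circ> rotation n r j) f)
      = q i j *\<^sub>C (mult_z j \<circ> rotation n r j) ((mult_z i \<circ> rotation n r i) f)"
    unfolding a(2) shift_operator_power_series[OF i a(1)] shift_operator_power_series[OF j a(1)]
      shift_operator_power_series[OF i ss[OF j a(1)]] shift_operator_power_series[OF j ss[OF i a(1)]] .
qed

end

section \<open>Telescoping the defect operator\<close>

lemma op_prod_Nil [simp]: "op_prod A [] h = h"
  by (simp add: op_prod_def)

lemma op_prod_Cons [simp]: "op_prod A (j # js) h = A j (op_prod A js h)"
  by (simp add: op_prod_def)

lemma op_prod_append [simp]: "op_prod A (is @ js) h = op_prod A is (op_prod A js h)"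
  by (induction "is") simp_all

lemma op_prod_cong: "(\<And>j. j \<in> set js \<Longrightarrow> A j = B j) \<Longrightarrow> op_prod A js h = op_prod B js h"
  by (induction js) simp_all

definition phase_invariant :: "('a::complex_vector \<Rightarrow> real) \<Rightarrow> bool"
  where "phase_invariant g \<longleftrightarrow> (\<forall>u x. cmod u = 1 \<longrightarrow> g (u *\<^sub>C x) = g x)"

text \<open>On quadratic forms \<open>g\<close>, composition with \<open>A j\<close> is the commuting family of maps
  \<open>X \<mapsto> T\<^sub>j X T\<^sub>j\<^sup>*\<close>; the three operators below are, for this map \<open>\<sigma>\<close>, the maps
  \<open>1 - \<sigma>\<close>, \<open>1 + \<sigma> + \<dots> + \<sigma>^(N-1)\<close> and their product \<open>1 - \<sigma>^N\<close>.\<close>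

definition diff_form :: "(nat \<Rightarrow> 'a \<Rightarrow> 'a) \<Rightarrow> nat \<Rightarrow> ('a \<Rightarrow> real) \<Rightarrow> 'a \<Rightarrow> real"
  where "diff_form A j g h = g h - g (A j h)"

definition sum_form :: "(nat \<Rightarrow> 'a \<Rightarrow> 'a) \<Rightarrow> nat \<Rightarrow> nat \<Rightarrow> ('a \<Rightarrow> real) \<Rightarrow> 'a \<Rightarrow> real"
  where "sum_form A N j g h = (\<Sum>k<N. g ((A j ^^ k) h))"

definition tel_form :: "(nat \<Rightarrow> 'a \<Rightarrow> 'a) \<Rightarrow> nat \<Rightarrow> nat \<Rightarrow> ('a \<Rightarrow> real) \<Rightarrow> 'a \<Rightarrow> real"
  where "tel_form A N j g h = g h - g ((A j ^^ N) h)"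

lemma sum_form_diff_form_same: "sum_form A N j (diff_form A j g) = tel_form A N j g"
proof
  fix h
  have "(\<Sum>k<N. g ((A j ^^ k) h) - g ((A j ^^ Suc k) h)) = g ((A j ^^ 0) h) - g ((A j ^^ N) h)"
    by (rule sum_lessThan_telescope')
  then show "sum_form A N j (diff_form A j g) h = tel_form A N j g h"
    by (simp add: sum_form_def diff_form_def tel_form_def)
qed

text \<open>Subsets are split by whether they contain the least index m. That index heads the sorted
  list, so after reversal \<open>A m\<close> acts directly on h, matching the outermost factor of
  the fold; the extra element accounts for the minus sign.\<close>

lemma szego_sum_eq_diff_forms:
  assumes "m \<le> Suc n"
  shows "(\<Sum>F\<in>Pow {m..n}. (-1) ^ card F * g (op_prod A (rev (sorted_list_of_set F)) h))
    = foldr (diff_form A) [m..<Suc n] g h"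
  using assms
proof (induction m arbitrary: h rule: inc_induct)
  case base
  then show ?case by simp
next
  case (step m)
  let ?G = "\<lambda>F h. (-1) ^ card F * g (op_prod A (rev (sorted_list_of_set F)) h)"
  have ins: "{m..n} = insert m {Suc m..n}"
    using step.hyps by auto
  have inj: "inj_on (insert m) (Pow {Suc m..n})"
  proof (rule inj_onI)
    fix F G
    assume "F \<in> Pow {Suc m..n}" "G \<in> Pow {Suc m..n}" and eq: "insert m F = insert m G"
    then have "m \<notin> F" "m \<notin> G"
      by auto
    with eq show "F = G"
      by (simp add: insert_ident)
  qed
  have G_insert: "?G (insert m F) h = - ?G F (A m h)" if F: "F \<in> Pow {Suc m..n}" for F
  proof -
    have fin: "finite F" and notin: "m \<notin> F" and less: "\<And>i. i \<in> F \<Longrightarrow> m < i"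
      using F by (auto intro: finite_subset)
    have "sorted_list_of_set (insert m F) = m # sorted_list_of_set F"
      using fin notin less by (simp add: sorted_list_of_set_insert insort_is_Cons less_imp_le)
    with fin notin show ?thesis by simp
  qed
  have "(\<Sum>F\<in>Pow {m..n}. ?G F h) = (\<Sum>F\<in>Pow {Suc m..n}. ?G F h) + (\<Sum>F\<in>insert m ` Pow {Suc m..n}. ?G F h)"
    unfolding ins Pow_insert by (rule sum.union_disjoint) auto
  also have "(\<Sum>F\<in>insert m ` Pow {Suc m..n}. ?G F h) = - (\<Sum>F\<in>Pow {Suc m..n}. ?G F (A m h))"
    unfolding sum.reindex[OF inj] o_def sum_negf[symmetric] by (intro sum.cong refl G_insert)
  finally show ?case
    using step by (simp add: upt_conv_Cons diff_form_def del: upt_Suc)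
qed

lemma box_sum_eq_sum_forms:
  assumes "m \<le> Suc n"
  shows "(\<Sum>k\<in>{m..n} \<rightarrow>\<^sub>E {..<N}. g (op_prod (\<lambda>j. A j ^^ k j) (rev [m..<Suc n]) h))
    = foldr (sum_form A N) [m..<Suc n] g h"
  using assms
proof (induction m arbitrary: h rule: inc_induct)
  case base
  then show ?case by simp
next
  case (step m)
  let ?G = "\<lambda>k h. g (op_prod (\<lambda>j. A j ^^ k j) (rev [Suc m..<Suc n]) h)"
  have ins: "{m..n} = insert m {Suc m..n}"
    using step.hyps by auto
  \<comment> \<open>The remaining product runs over indices above m and does not read coordinate
    m.\<close>
  have upd: "?G (k(m := y)) h = ?G k h" for k y h
    by (rule arg_cong[of _ _ g], rule op_prod_cong) auto
  have "(\<Sum>k\<in>{m..n} \<rightarrow>\<^sub>E {..<N}. g (op_prod (\<lambda>j. A j ^^ k j) (rev [m..<Suc n]) h))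
      = (\<Sum>k\<in>{m..n} \<rightarrow>\<^sub>E {..<N}. ?G k ((A m ^^ k m) h))"
    using step.hyps by (simp add: upt_conv_Cons del: upt_Suc)
  also have "\<dots> = (\<Sum>(y, k)\<in>{..<N} \<times> ({Suc m..n} \<rightarrow>\<^sub>E {..<N}). ?G k ((A m ^^ y) h))"
    unfolding ins PiE_insert_eq
    by (subst sum.reindex[OF inj_combinator]) (simp, simp only: o_def case_prod_unfold fun_upd_same upd)
  also have "\<dots> = (\<Sum>y<N. foldr (sum_form A N) [Suc m..<Suc n] g ((A m ^^ y) h))"
    unfolding sum.cartesian_product[symmetric] step.IH ..
  also have "\<dots> = foldr (sum_form A N) [m..<Suc n] g h"
    using step.hyps by (simp add: upt_conv_Cons sum_form_def del: upt_Suc)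
  finally show ?case .
qed

section \<open>Commutation up to phases, and the limit from purity\<close>

context
  fixes I :: "nat set" and A :: "nat \<Rightarrow> 'a::chilbert_space \<Rightarrow> 'a" and w :: "nat \<Rightarrow> nat \<Rightarrow> complex"
  assumes lin: "\<And>i. i \<in> I \<Longrightarrow> clinear_on UNIV (A i)"
    and w_unimodular: "\<And>i j. i \<in> I \<Longrightarrow> j \<in> I \<Longrightarrow> cmod (w i j) = 1"
    and commute: "\<And>i j h. i \<in> I \<Longrightarrow> j \<in> I \<Longrightarrow> A i (A j h) = w i j *\<^sub>C A j (A i h)"
begin

lemma A_funpow_scale: "i \<in> I \<Longrightarrow> (A i ^^ k) (c *\<^sub>C h) = c *\<^sub>C (A i ^^ k) h"
  by (induction k) (simp_all add: clinear_onD[OF lin])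

lemma A_funpow_commute:
  assumes "i \<in> I" "j \<in> I"
  shows "(A i ^^ k) (A j h) = (w i j ^ k) *\<^sub>C A j ((A i ^^ k) h)"
  by (induction k)
    (simp_all add: scaleC_one clinear_onD[OF lin] assms commute[OF assms] scaleC_scaleC mult.commute)

lemma phase_invariant_diff_form: "i \<in> I \<Longrightarrow> phase_invariant g \<Longrightarrow> phase_invariant (diff_form A i g)"
  by (simp add: phase_invariant_def diff_form_def clinear_onD[OF lin])

lemma phase_invariant_sum_form: "i \<in> I \<Longrightarrow> phase_invariant g \<Longrightarrow> phase_invariant (sum_form A N i g)"
  by (simp add: phase_invariant_def sum_form_def A_funpow_scale)

lemma phase_invariant_foldr:
  assumes "set js \<subseteq> I" "phase_invariant g"
  shows "phase_invariant (foldr (diff_form A) js g)" "phase_invariant (foldr (sum_form A N) js g)"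
  using assms by (induction js) (auto intro: phase_invariant_diff_form phase_invariant_sum_form)

lemma sum_form_diff_form_commute:
  assumes "i \<in> I" "j \<in> I" "phase_invariant g"
  shows "sum_form A N i (diff_form A j g) = diff_form A j (sum_form A N i g)"
proof
  fix h
  have "g (A j ((A i ^^ k) h)) = g ((A i ^^ k) (A j h))" for k
    using assms w_unimodular unfolding A_funpow_commute[OF assms(1,2)]
    by (simp add: phase_invariant_def norm_power)
  then show "sum_form A N i (diff_form A j g) h = diff_form A j (sum_form A N i g) h"
    by (simp add: sum_form_def diff_form_def sum_subtractf)
qed

lemma sum_forms_diff_form_commute:
  assumes "set js \<subseteq> I" "j \<in> I" "phase_invariant g"
  shows "foldr (sum_form A N) js (diff_form A j g) = diff_form A j (foldr (sum_form A N) js g)"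
  using assms by (induction js) (simp_all add: sum_form_diff_form_commute phase_invariant_foldr)

text \<open>The difference at the head index is moved outward through the sums of the tail, where it
  meets the sum of its own index and telescopes.\<close>

lemma sum_forms_diff_forms:
  assumes "set js \<subseteq> I" "phase_invariant g"
  shows "foldr (sum_form A N) js (foldr (diff_form A) js g) = foldr (tel_form A N) js g"
  using assms
  by (induction js) (simp_all add: sum_forms_diff_form_commute phase_invariant_foldr sum_form_diff_form_same)

context
  assumes contr: "\<And>i h. i \<in> I \<Longrightarrow> norm (A i h) \<le> norm h"
    and pure: "\<And>i h. i \<in> I \<Longrightarrow> (\<lambda>N. norm ((A i ^^ N) h)) \<longlonglongrightarrow> 0"
begin

lemma A_funpow_norm_le: "i \<in> I \<Longrightarrow> norm ((A i ^^ k) h) \<le> norm h"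
proof (induction k)
  case (Suc k)
  then show ?case
    using order_trans[OF contr[of i "(A i ^^ k) h"]] by simp
qed simp

text \<open>Uniformity in N is the point: in the limit below both the form and the vector it is
  evaluated at depend on N.\<close>

lemma tel_forms_bounded:
  assumes "set js \<subseteq> I"
  shows "\<bar>foldr (tel_form A N) js (\<lambda>x. (norm x)\<^sup>2) h\<bar> \<le> 2 ^ length js * (norm h)\<^sup>2"
  using assms
proof (induction js arbitrary: h)
  case (Cons j js)
  let ?G = "foldr (tel_form A N) js (\<lambda>x. (norm x)\<^sup>2)"
  have "\<bar>?G ((A j ^^ N) h)\<bar> \<le> 2 ^ length js * (norm ((A j ^^ N) h))\<^sup>2"
    using Cons by simp
  also have "\<dots> \<le> 2 ^ length js * (norm h)\<^sup>2"
    using Cons.prems by (intro mult_left_mono power_mono A_funpow_norm_le) auto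
  finally have "\<bar>?G ((A j ^^ N) h)\<bar> \<le> 2 ^ length js * (norm h)\<^sup>2" .
  moreover have "\<bar>?G h\<bar> \<le> 2 ^ length js * (norm h)\<^sup>2"
    using Cons by simp
  ultimately have "\<bar>?G h - ?G ((A j ^^ N) h)\<bar> \<le> 2 ^ length js * (norm h)\<^sup>2 + 2 ^ length js * (norm h)\<^sup>2"
    by linarith
  then show ?case
    by (simp add: tel_form_def[of A _ j] mult_ac)
qed simp

text \<open>Each further factor subtracts the same form at the N-th power of \<open>A j\<close>
  applied to h, which the uniform bound and purity send to zero.\<close>

lemma tel_forms_tendsto:
  assumes "set js \<subseteq> I"
  shows "(\<lambda>N. foldr (tel_form A N) js (\<lambda>x. (norm x)\<^sup>2) h) \<longlonglongrightarrow> (norm h)\<^sup>2"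
  using assms
proof (induction js)
  case (Cons j js)
  let ?G = "\<lambda>N. foldr (tel_form A N) js (\<lambda>x. (norm x)\<^sup>2)"
  have "(\<lambda>N. 2 ^ length js * (norm ((A j ^^ N) h))\<^sup>2) \<longlonglongrightarrow> 2 ^ length js * 0\<^sup>2"
    using Cons.prems by (intro tendsto_intros pure) simp
  then have lim0: "(\<lambda>N. 2 ^ length js * (norm ((A j ^^ N) h))\<^sup>2) \<longlonglongrightarrow> 0"
    by simp
  have "(\<lambda>N. ?G N ((A j ^^ N) h)) \<longlonglongrightarrow> 0"
    by (rule Lim_null_comparison[OF always_eventually lim0])
      (use tel_forms_bounded Cons.prems in simp)
  with Cons have "(\<lambda>N. ?G N h - ?G N ((A j ^^ N) h)) \<longlonglongrightarrow> (norm h)\<^sup>2 - 0"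
    by (intro tendsto_diff) auto
  then show ?case
    by (simp add: tel_form_def[of A _ j])
qed simp

end

end

text \<open>Boxes are cofinal among finite index sets, so for nonnegative terms the limit along
  boxes already is the unordered sum.\<close>

lemma has_sum_box_exhaustion:
  fixes f :: "(nat \<Rightarrow> nat) \<Rightarrow> real"
  assumes nonneg: "\<And>k. 0 \<le> f k" and lim: "(\<lambda>N. \<Sum>k\<in>{1..n} \<rightarrow>\<^sub>E {..<N}. f k) \<longlonglongrightarrow> s"
  shows "(f has_sum s) (multi_indices n)"
proof -
  have fin: "finite ({1..n} \<rightarrow>\<^sub>E {..<N :: nat})" for N
    by (intro finite_PiE) auto
  have "incseq (\<lambda>N. \<Sum>k\<in>{1..n} \<rightarrow>\<^sub>E {..<N}. f k)"
    by (intro incseq_SucI sum_mono2 fin PiE_mono nonneg) auto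
  then have box_le: "(\<Sum>k\<in>{1..n} \<rightarrow>\<^sub>E {..<N}. f k) \<le> s" for N
    using lim by (rule incseq_le)
  have fin_le: "sum f F \<le> s" if F: "finite F" "F \<subseteq> multi_indices n" for F
  proof -
    obtain N where "F \<subseteq> {1..n} \<rightarrow>\<^sub>E {..<N}"
      using finite_multi_indices_subset_box[OF F] .
    then have "sum f F \<le> (\<Sum>k\<in>{1..n} \<rightarrow>\<^sub>E {..<N}. f k)"
      by (intro sum_mono2 fin nonneg)
    with box_le show ?thesis
      using order_trans by blast
  qed
  have summable: "f summable_on multi_indices n"
    by (rule nonneg_bdd_above_summable_on) (use nonneg fin_le in \<open>auto intro!: bdd_aboveI2[where M = s]\<close>)
  have "(\<Sum>k\<in>{1..n} \<rightarrow>\<^sub>E {..<N}. f k) \<le> infsum f (multi_indices n)" for N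
    by (rule finite_sum_le_infsum[OF summable fin]) (auto simp: multi_indices_def PiE_iff nonneg)
  then have "s \<le> infsum f (multi_indices n)"
    using LIMSEQ_le_const2[OF lim] by blast
  moreover have "infsum f (multi_indices n) \<le> s"
    by (rule infsum_le_finite_sums[OF summable fin_le])
  ultimately show ?thesis
    using has_sum_infsum[OF summable] by simp
qed

section \<open>The dilation\<close>

lemma op_prod_cadjoint:
  assumes "\<And>j. j \<in> set js \<Longrightarrow> contraction_on UNIV cinner (T j)"
  shows "cinner (op_prod T js x) y = cinner x (op_prod (\<lambda>j. cadjoint (T j)) (rev js) y)"
  using assms by (induction js arbitrary: y) (simp_all add: cadjoint_contraction)

lemma csubspace_on_closure_range:
  fixes S :: "'a::complex_inner \<Rightarrow> 'b::complex_inner"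
  assumes "clinear_on UNIV S"
  shows "csubspace_on (closure (range S))"
  unfolding csubspace_on_def
proof (intro conjI ballI allI)
  have "S 0 = 0"
    using clinear_onD(2)[OF assms, of 0 0] by simp
  then show "0 \<in> closure (range S)"
    using closure_subset[of "range S"] by (metis rangeI subsetD)
next
  fix x y
  assume "x \<in> closure (range S)" "y \<in> closure (range S)"
  then obtain u v where u: "\<And>j. u j \<in> range S" "u \<longlonglongrightarrow> x" and v: "\<And>j. v j \<in> range S" "v \<longlonglongrightarrow> y"
    unfolding closure_sequential by blast
  have uv: "u j + v j \<in> range S" for j
  proof -
    obtain a b where "u j = S a" "v j = S b"
      using u(1)[of j] v(1)[of j] by auto
    then have "u j + v j = S (a + b)"
      by (simp add: clinear_onD[OF assms])
    then show ?thesis by simp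
  qed
  then show "x + y \<in> closure (range S)"
    unfolding closure_sequential
    by (intro exI[of _ "\<lambda>j. u j + v j"] conjI allI uv tendsto_add[OF u(2) v(2)])
next
  fix c x
  assume x: "x \<in> closure (range S)"
  have sub: "(\<lambda>v. c *\<^sub>C v) ` range S \<subseteq> range S"
    using clinear_onD(2)[OF assms, symmetric] by auto
  have "c *\<^sub>C x \<in> (\<lambda>v. c *\<^sub>C v) ` closure (range S)"
    using x by (rule imageI)
  then show "c *\<^sub>C x \<in> closure (range S)"
    by (rule subsetD[OF closure_mono[OF sub] subsetD[OF
          closure_bounded_linear_image_subset[OF bounded_linear_scaleC]]])
qed

section \<open>Phases and coefficients of the dilation\<close>

definition root_phase :: "nat \<Rightarrow> (nat \<Rightarrow> nat \<Rightarrow> complex) \<Rightarrow> (nat \<Rightarrow> nat) \<Rightarrow> complex"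
  where "root_phase n r k = (\<Prod>(i, j) \<in> {(i, j). 1 \<le> i \<and> i < j \<and> j \<le> n}. r i j ^ (k i * k j))"

text \<open>Only pairs containing m feel the raised exponent. Each such pair is labelled by its
  other member, which stands on the left or on the right according to its position relative to
  m.\<close>

lemma root_phase_Suc:
  assumes m: "m \<in> {1..n}"
  shows "root_phase n r (k(m := Suc (k m)))
    = root_phase n r k * (\<Prod>i\<in>{1..n} - {m}. if i < m then r i m ^ k i else r m i ^ k i)"
proof -
  let ?P = "{(i, j). 1 \<le> i \<and> i < j \<and> j \<le> n}"
  define f where "f = (\<lambda>(i, j). if j = m then r i m ^ k i else if i = m then r m j ^ k j else 1)"
  have fin: "finite ?P"
    by (rule finite_subset[of _ "{1..n} \<times> {1..n}"]) auto
  have "root_phase n r (k(m := Suc (k m))) = (\<Prod>p\<in>?P. (case p of (i, j) \<Rightarrow> r i j ^ (k i * k j)) * f p)"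
    unfolding root_phase_def by (intro prod.cong) (auto simp: f_def power_add)
  also have "\<dots> = root_phase n r k * prod f ?P"
    unfolding root_phase_def by (rule prod.distrib)
  also have "prod f ?P = prod f {(i, j) \<in> ?P. i = m \<or> j = m}"
    using fin by (intro prod.mono_neutral_right) (auto simp: f_def split: if_splits)
  also have "\<dots> = (\<Prod>i\<in>{1..n} - {m}. if i < m then r i m ^ k i else r m i ^ k i)"
    by (rule prod.reindex_bij_witness[where j = "\<lambda>(i, j). if j = m then i else j"
          and i = "\<lambda>i. if i < m then (i, m) else (m, i)"])
      (use m in \<open>auto simp: f_def\<close>)
  finally show ?thesis .
qed

text \<open>Cut off outside the multi-indices so that it can belong to
  \<open>square_summable\<close>; the power series does not see the difference.\<close>

definition dilation_coeffs ::
  "nat \<Rightarrow> (nat \<Rightarrow> nat \<Rightarrow> complex) \<Rightarrow> (nat \<Rightarrow> 'a::chilbert_space \<Rightarrow> 'a) \<Rightarrow> 'a \<Rightarrow> (nat \<Rightarrow> nat) \<Rightarrow> 'a"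
  where "dilation_coeffs n r T h k =
    (if k \<in> multi_indices n then root_phase n r k *\<^sub>C defect_op n T (adjoint_power n T k h) else 0)"

lemma dilation_map_eq_power_series: "dilation_map n r T h = power_series n (dilation_coeffs n r T h)"
  unfolding dilation_map_def power_series_def dilation_coeffs_def root_phase_def
  by (intro ext if_cong infsum_cong refl) simp

theorem theorem3p5:
  fixes n :: nat
    and q r :: "nat \<Rightarrow> nat \<Rightarrow> complex"
    and T :: "nat \<Rightarrow> 'h::chilbert_space \<Rightarrow> 'h"
  assumes q_unimodular: "\<And>i j. i \<in> {1..n} \<Longrightarrow> j \<in> {1..n} \<Longrightarrow> norm (q i j) = 1"
    and q_diag: "\<And>i. i \<in> {1..n} \<Longrightarrow> q i i = 1"
    and q_cnj: "\<And>i j. i \<in> {1..n} \<Longrightarrow> j \<in> {1..n} \<Longrightarrow> q i j = cnj (q j i)"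
    and r_root: "\<And>i j. i \<in> {1..n} \<Longrightarrow> j \<in> {1..n} \<Longrightarrow> (r i j)\<^sup>2 = q i j"
    and r_diag: "\<And>i. i \<in> {1..n} \<Longrightarrow> r i i = 1"
    and r_cnj: "\<And>i j. i \<in> {1..n} \<Longrightarrow> j \<in> {1..n} \<Longrightarrow> r j i = cnj (r i j)"
    and T_class: "q_commuting_contractions n q UNIV cinner T"
    and T_pure: "pure_tuple n T"
    and T_szego: "pos_op (szego_inv n T)"
  shows "isometry_on UNIV cinner (hardy n (defect_space n T)) (hardy_inner n) (dilation_map n r T) \<and>
    (\<forall>m\<in>{1..n}. \<forall>h.
      dilation_map n r T (cadjoint (T m) h) =
      adjoint_on (hardy n (defect_space n T)) (hardy_inner n) (mult_z m \<circ> rotation n r m)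
        (dilation_map n r T h)) \<and>
    isometric_dilation n q UNIV cinner T
      (hardy n (defect_space n T)) (hardy_inner n) (\<lambda>m. mult_z m \<circ> rotation n r m)"
proof -
  define A where "A j = cadjoint (T j)" for j
  define D where "D = defect_op n T"
  define E where "E = defect_space n T"
  let ?\<Pi> = "dilation_map n r T"

  have T: "contraction_on UNIV cinner (T i)" if "i \<in> {1..n}" for i
    using T_class that by (simp add: q_commuting_contractions_def)
  have T_commute: "T i (T j x) = q i j *\<^sub>C T j (T i x)" if "i \<in> {1..n}" "j \<in> {1..n}" for i j x
    using T_class that unfolding q_commuting_contractions_def by blast
  have A_lin: "clinear_on UNIV (A i)" if "i \<in> {1..n}" for i
    unfolding A_def by (rule cadjoint_contraction_clinear[OF T[OF that]])
  \<comment> \<open>Taking adjoints reverses the products and conjugates the scalar. Conjugation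
    turns \<open>q j i\<close> into \<open>q i j\<close>, so the adjoints satisfy the relations of T
    themselves.\<close>
  have A_commute: "A i (A j h) = q i j *\<^sub>C A j (A i h)" if i: "i \<in> {1..n}" and j: "j \<in> {1..n}" for i j h
  proof (rule cinner_eq_zero_all)
    fix x
    have "cinner x (A i (A j h)) = cinner (T j (T i x)) h"
      by (simp add: A_def cadjoint_contraction[OF T[OF i]] cadjoint_contraction[OF T[OF j]])
    also have "\<dots> = q j i * cinner x (A j (A i h))"
      unfolding T_commute[OF j i]
      by (simp add: A_def cadjoint_contraction[OF T[OF i]] cadjoint_contraction[OF T[OF j]] cinner_scaleC_left)
    finally show "cinner x (A i (A j h)) = cinner x (q i j *\<^sub>C A j (A i h))"
      using q_cnj[OF j i] by (simp add: cinner_scaleC_right)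
  qed
  have A_contr: "norm (A i h) \<le> norm h" if "i \<in> {1..n}" for i h
    unfolding A_def by (rule norm_cadjoint_le[OF T[OF that]])
  have A_pure: "(\<lambda>N. norm ((A i ^^ N) h)) \<longlonglongrightarrow> 0" if "i \<in> {1..n}" for i h
    using T_pure that by (simp add: pure_tuple_def A_def)
  have funpow_scale: "(A i ^^ p) (c *\<^sub>C x) = c *\<^sub>C (A i ^^ p) x" if "i \<in> {1..n}" for i p c x
    by (rule A_funpow_scale[where w = q, OF A_lin q_unimodular A_commute that])
  have funpow_commute: "(A i ^^ p) (A j x) = (q i j ^ p) *\<^sub>C A j ((A i ^^ p) x)"
    if "i \<in> {1..n}" "j \<in> {1..n}" for i j p x
    by (rule A_funpow_commute[where w = q, OF A_lin q_unimodular A_commute that])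
  have AP: "adjoint_power n T k h = op_prod (\<lambda>j. A j ^^ k j) (rev [1..<Suc n]) h" for k h
    by (simp add: adjoint_power_def A_def del: upt_Suc)

  have D: "pos_op D" "\<And>x. D (D x) = szego_inv n T x" "\<And>x. D x \<in> E"
    using op_sqrt_pos_op[OF T_szego] by (simp_all add: D_def E_def defect_op_def defect_space_def)
  have D_lin: "clinear_on UNIV D"
    using D(1) by (simp add: pos_op_def)
  have E: "csubspace_on E" "closed E"
    unfolding E_def defect_space_def using T_szego
    by (simp_all add: csubspace_on_closure_range pos_op_def)

  have norm_D: "(norm (D h))\<^sup>2 = foldr (diff_form A) [1..<Suc n] (\<lambda>x. (norm x)\<^sup>2) h" for h
  proof -
    \<comment> \<open>The adjoint of an ordered product is the product of adjoints in reverse order,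
      so each Szego term contributes a signed squared norm to the form.\<close>
    have term_eq: "Re (cinner ((-1) ^ card F *\<^sub>C op_prod T (sorted_list_of_set F)
        (op_prod (\<lambda>j. cadjoint (T j)) (rev (sorted_list_of_set F)) h)) h)
      = (-1) ^ card F * (norm (op_prod A (rev (sorted_list_of_set F)) h))\<^sup>2"
      if "F \<in> Pow {1..n}" for F
    proof -
      have "finite F"
        using that finite_subset by auto
      then have "cinner (op_prod T (sorted_list_of_set F) x) h
          = cinner x (op_prod A (rev (sorted_list_of_set F)) h)" for x
        unfolding A_def using that T by (intro op_prod_cadjoint) auto
      moreover have "(-1 :: complex) ^ card F = complex_of_real ((-1) ^ card F)"
        by simp
      ultimately show ?thesis
        unfolding A_def[symmetric]
        by (simp only: cinner_scaleC_left cinner_self Re_complex_of_real flip: of_real_mult)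
    qed
    have "(norm (D h))\<^sup>2 = Re (cinner (D (D h)) h)"
      using pos_op_selfadj[OF D(1)] by (simp add: selfadj_def cinner_self)
    also have "\<dots> = (\<Sum>F\<in>Pow {1..n}. (-1) ^ card F * (norm (op_prod A (rev (sorted_list_of_set F)) h))\<^sup>2)"
      unfolding D(2) szego_inv_def cinner_sum_left Re_sum by (intro sum.cong refl term_eq)
    also have "\<dots> = foldr (diff_form A) [1..<Suc n] (\<lambda>x. (norm x)\<^sup>2) h"
      by (rule szego_sum_eq_diff_forms) simp
    finally show ?thesis .
  qed
  \<comment> \<open>The isometry in disguise: the phases in the coefficients are unimodular, so this
    is the squared Hardy norm of the image of h.\<close>
  have D_has_sum: "((\<lambda>k. (norm (D (adjoint_power n T k h)))\<^sup>2) has_sum (norm h)\<^sup>2) (multi_indices n)" for h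
  proof (rule has_sum_box_exhaustion)
    have inv: "phase_invariant (\<lambda>x::'h. (norm x)\<^sup>2)"
      by (simp add: phase_invariant_def)
    have sub: "set [1..<Suc n] \<subseteq> {1..n}"
      by auto
    have "(\<Sum>k\<in>{1..n} \<rightarrow>\<^sub>E {..<N}. (norm (D (adjoint_power n T k h)))\<^sup>2)
        = foldr (tel_form A N) [1..<Suc n] (\<lambda>x. (norm x)\<^sup>2) h" for N
    proof -
      have "(\<Sum>k\<in>{1..n} \<rightarrow>\<^sub>E {..<N}. (norm (D (adjoint_power n T k h)))\<^sup>2)
          = foldr (sum_form A N) [1..<Suc n] (foldr (diff_form A) [1..<Suc n] (\<lambda>x. (norm x)\<^sup>2)) h"
        unfolding AP norm_D by (rule box_sum_eq_sum_forms) simp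
      then show ?thesis
        using sum_forms_diff_forms[where I = "{1..n}" and w = q, OF A_lin q_unimodular A_commute sub inv]
        by simp
    qed
    then show "(\<lambda>N. \<Sum>k\<in>{1..n} \<rightarrow>\<^sub>E {..<N}. (norm (D (adjoint_power n T k h)))\<^sup>2) \<longlonglongrightarrow> (norm h)\<^sup>2"
      using tel_forms_tendsto[where I = "{1..n}" and w = q,
          OF A_lin q_unimodular A_commute A_contr A_pure sub]
      by simp
  qed simp

  have r_unimodular: "norm (r i j) = 1" if "i \<in> {1..n}" "j \<in> {1..n}" for i j
  proof -
    have "(norm (r i j))\<^sup>2 = 1"
      using r_root[OF that] q_unimodular[OF that] by (simp flip: norm_power)
    then show ?thesis
      by (simp add: power2_eq_1_iff) (use norm_ge_zero[of "r i j"] in linarith)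
  qed
  have r_swap: "r i j = q i j * r j i" if "i \<in> {1..n}" "j \<in> {1..n}" for i j
  proof -
    have "q i j * r j i = r i j * (r i j * cnj (r i j))"
      using r_root[OF that] r_cnj[OF that] by (simp add: power2_eq_square mult.assoc)
    also have "r i j * cnj (r i j) = 1"
      using r_unimodular[OF that] by (simp flip: complex_norm_square)
    finally show ?thesis by simp
  qed
  have norm_phase: "norm (root_phase n r k) = 1" for k
    unfolding root_phase_def prod_norm[symmetric]
    by (intro prod.neutral) (auto simp: norm_power r_unimodular)

  note c_def = dilation_coeffs_def[of n r T, folded D_def]
  let ?c = "dilation_coeffs n r T"
  have c_norm: "((\<lambda>k. (norm (?c h k))\<^sup>2) has_sum (norm h)\<^sup>2) (multi_indices n)" for h
    using D_has_sum[of h]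
    by (rule has_sum_cong[THEN iffD1, rotated]) (simp add: c_def norm_phase)
  have c_sum: "?c h \<in> square_summable n E" for h
    using c_norm[of h] D(3) E(1)
    by (auto simp: square_summable_def c_def csubspace_on_def has_sum_imp_summable)
  have prod_lin: "clinear_on UNIV (op_prod (\<lambda>j. A j ^^ k j) js)" if "set js \<subseteq> {1..n}" for js k
  proof -
    have "clinear_on UNIV (A j ^^ p)" if "j \<in> {1..n}" for j p
      by (induction p) (use A_lin[OF that] in \<open>auto simp: clinear_on_def\<close>)
    with that show ?thesis
      by (induction js) (auto simp: clinear_on_def)
  qed
  have AP_lin: "clinear_on UNIV (adjoint_power n T k)" for k
    unfolding AP[abs_def] by (rule prod_lin) auto

  have isometry: "isometry_on UNIV cinner (hardy n E) (hardy_inner n) ?\<Pi>"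
    unfolding isometry_on_def clinear_on_def dilation_map_eq_power_series
  proof (intro conjI ballI allI)
    fix x y :: 'h and c
    have "?c (x + y) = ?c x + ?c y"
      by (auto simp: fun_eq_iff c_def clinear_onD[OF AP_lin] clinear_onD[OF D_lin] scaleC_add_right)
    then show "power_series n (?c (x + y)) = power_series n (?c x) + power_series n (?c y)"
      using power_series_add[OF c_sum c_sum] by simp
    have "?c (c *\<^sub>C x) = c *\<^sub>C ?c x"
      by (auto simp: fun_eq_iff c_def clinear_onD[OF AP_lin] clinear_onD[OF D_lin] scaleC_fun_def
          scaleC_scaleC mult.commute)
    then show "power_series n (?c (c *\<^sub>C x)) = c *\<^sub>C power_series n (?c x)"
      using power_series_scale[OF c_sum] by simp
    show "ip_norm (hardy_inner n) (power_series n (?c x)) = ip_norm cinner x"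
      unfolding hardy_norm_power_series[OF c_sum] infsumI[OF c_norm] by simp
  qed (use hardyI[OF c_sum] in auto)

  have intertwining: "?\<Pi> (A m h)
      = adjoint_on (hardy n E) (hardy_inner n) (mult_z m \<circ> rotation n r m) (?\<Pi> h)"
    if m: "m \<in> {1..n}" for m h
  proof -
    \<comment> \<open>In the adjoint power the factor with index 1 acts first, so an adjoint applied
      beforehand must pass all powers of index below m; passing index i costs
      \<open>q i m ^ k i\<close>.\<close>
    have push: "op_prod (\<lambda>j. A j ^^ k j) (rev [1..<p]) (A m h)
        = (\<Prod>i\<in>{1..<p}. q i m ^ k i) *\<^sub>C A m (op_prod (\<lambda>j. A j ^^ k j) (rev [1..<p]) h)"
      if "1 \<le> p" "p \<le> m" for p k
      using that
    proof (induction p rule: dec_induct)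
      case (step p)
      then have p: "p \<in> {1..n}"
        using m by auto
      show ?case
        using step by (simp add: atLeastLessThanSuc scaleC_scaleC mult.commute
            funpow_scale[OF p] funpow_commute[OF p m])
    qed (simp add: scaleC_one)
    have AP_m: "adjoint_power n T k (A m h)
        = (\<Prod>i\<in>{1..<m}. q i m ^ k i) *\<^sub>C adjoint_power n T (k(m := Suc (k m))) h" for k
    proof -
      have split: "[1..<Suc n] = [1..<m] @ m # [Suc m..<Suc n]"
        using m upt_add_eq_append[of 1 m "Suc n - m"] by (simp add: upt_conv_Cons del: upt_Suc)
      let ?R = "op_prod (\<lambda>j. A j ^^ k j) (rev [Suc m..<Suc n])"
      let ?L = "op_prod (\<lambda>j. A j ^^ k j) (rev [1..<m])"
      have lin: "clinear_on UNIV (\<lambda>x. ?R ((A m ^^ k m) x))"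
      proof -
        have "set (rev [Suc m..<Suc n] @ [m]) \<subseteq> {1..n}"
          using m by auto
        from prod_lin[OF this, of k] show ?thesis
          by (simp add: clinear_on_def del: upt_Suc)
      qed
      have "adjoint_power n T k (A m h) = ?R ((A m ^^ k m) (?L (A m h)))"
        unfolding AP split by simp
      \<comment> \<open>The operator that has passed \<open>?L\<close> merges with the power of
        \<open>A m\<close> and raises its exponent by one.\<close>
      also have "\<dots> = (\<Prod>i\<in>{1..<m}. q i m ^ k i) *\<^sub>C ?R ((A m ^^ Suc (k m)) (?L h))"
        using push[of m k] m clinear_onD(2)[OF lin] by (simp add: funpow_swap1)
      also have "?L h = op_prod (\<lambda>j. A j ^^ (k(m := Suc (k m))) j) (rev [1..<m]) h"
        by (rule op_prod_cong) auto
      also have "?R x = op_prod (\<lambda>j. A j ^^ (k(m := Suc (k m))) j) (rev [Suc m..<Suc n]) x" for x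
        by (rule op_prod_cong) auto
      finally show ?thesis
        unfolding AP split by simp
    qed
    have phase: "root_phase n r k * (\<Prod>i\<in>{1..<m}. q i m ^ k i)
        = cnj (monomial n (r m) k) * root_phase n r (k(m := Suc (k m)))" for k
    proof -
      let ?s = "\<lambda>i. if i < m then r i m ^ k i else r m i ^ k i"
      \<comment> \<open>For i < m the conjugate of \<open>r m i\<close> is \<open>r i m\<close>, and
        the two roots multiply to \<open>q i m\<close>; for i > m a unimodular number meets its own
        conjugate. The index i = m is absent because \<open>r m m\<close> is 1.\<close>
      have s: "cnj (r m i ^ k i) * ?s i = (if i < m then q i m ^ k i else 1)" if "i \<in> {1..n} - {m}" for i
      proof (cases "i < m")
        case True
        then show ?thesis
          using r_root[of i m] r_cnj[of m i] that m
          by (simp add: power2_eq_square flip: power_mult_distrib)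
      next
        case False
        have "cnj (r m i) * r m i = 1"
          using r_unimodular[of m i] that m by (simp add: mult.commute flip: complex_norm_square)
        with False show ?thesis
          by (simp flip: power_mult_distrib)
      qed
      have "cnj (monomial n (r m) k) = (\<Prod>i\<in>{1..n} - {m}. cnj (r m i ^ k i))"
        unfolding monomial_split[OF m] using r_diag[OF m] by simp
      then have "cnj (monomial n (r m) k) * prod ?s ({1..n} - {m})
          = (\<Prod>i\<in>{1..n} - {m}. cnj (r m i ^ k i) * ?s i)"
        by (simp only: prod.distrib)
      also have "\<dots> = (\<Prod>i\<in>{1..n} - {m}. if i < m then q i m ^ k i else 1)"
        by (rule prod.cong[OF refl s])
      also have "\<dots> = (\<Prod>i\<in>{1..<m}. q i m ^ k i)"
        using m by (intro prod.mono_neutral_cong_right) auto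
      finally show ?thesis
        unfolding root_phase_Suc[OF m] by (simp add: mult_ac)
    qed
    have "?c (A m h) k = backshift_coeffs n r m (?c h) k" for k
      using phase[of k] m by (simp add: c_def backshift_coeffs_def multi_index_upd[OF m] AP_m
          clinear_onD[OF D_lin] scaleC_scaleC)
    then have "?c (A m h) = backshift_coeffs n r m (?c h)" ..
    moreover have "adjoint_on (hardy n E) (hardy_inner n) (mult_z m \<circ> rotation n r m) (power_series n (?c h))
        = power_series n (backshift_coeffs n r m (?c h))"
      by (rule adjoint_shift_operator[OF r_unimodular E m c_sum])
    ultimately show ?thesis
      by (simp only: dilation_map_eq_power_series)
  qed

  have V_commuting: "q_commuting_contractions n q (hardy n E) (hardy_inner n) (\<lambda>m. mult_z m \<circ> rotation n r m)"
    by (rule shift_operators_q_commuting[OF r_unimodular E q_diag r_swap])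
  have V_isometry: "isometry_on (hardy n E) (hardy_inner n) (hardy n E) (hardy_inner n) (mult_z m \<circ> rotation n r m)"
    if "m \<in> {1..n}" for m
    by (rule shift_operator_isometry[OF r_unimodular E that])
  have "isometric_dilation n q UNIV cinner T (hardy n E) (hardy_inner n) (\<lambda>m. mult_z m \<circ> rotation n r m)"
    unfolding isometric_dilation_def
    using hilbert_space_on_hardy[OF E] V_commuting V_isometry isometry intertwining
    unfolding A_def by blast
  with isometry intertwining show ?thesis
    by (simp add: A_def E_def)
qed

end
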